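(* Let $k\ge2$, $0\le\alpha<1$, and let $G$ be a $k$-uniform hypertree with $m$ edges and exactly $t\ge2$ pendant edges. Then $\rho_\alpha(G)\le\rho_\alpha(T_{m,t,k})$, with equality if and only if $G\cong T_{m,t,k}$.
   Context: Hypergraphs are finite with edges being sets; $k$-uniform means every edge has $k$ vertices; the degree of a vertex is the number of edges containing it. $\mathcal A_\alpha(G)=\alpha\mathcal D(G)+(1-\alpha)\mathcal A(G)$, where $\mathcal A(G)$ is the order-$k$ tensor with $(i_1,\dots,i_k)$-entry $\frac1{(k-1)!}$ if $\{i_1,\dots,i_k\}\in E(G)$ and $0$ otherwise, and $\mathcal D(G)$ is the diagonal tensor of degrees; for an order-$k$ tensor $\mathcal T$, $(\mathcal Tx)_i=\sum_{i_2,\dots,i_k}\mathcal T_{ii_2\dots i_k}x_{i_2}\cdots x_{i_k}$ and $\lambda$ is an eigenvalue if $\mathcal Tx=\lambda x^{[k-1]}$ for some $x\ne0$; $\rho_\alpha(G)$ is the largest modulus of an eigenvalue of $\mathcal A_\alpha(G)$. A path is an alternating sequence of distinct vertices and distinct edges $(v_0,e_1,\dots,e_s,v_s)$ with $v_{i-1},v_i\in e_i$, of length $s$; a cycle is such a sequence with at least two distinct edges and distinct vertices except $v_0=v_s$; a hypertree is a connected hypergraph with no cycles. A pendant edge is an edge $e$ containing a vertex $v_0$ with $d(v_0)\ge2$ such that all other vertices of $e$ have degree $1$. A pendant path of length $s$ at $v_0$ is a path $(v_0,e_1,v_1,\dots,e_s,v_s)$ with $d(v_0)\ge2$, $d(v_i)=2$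 for $1\le i\le s-1$, $d(v_s)=1$, and all vertices of $e_i$ other than $v_{i-1},v_i$ of degree $1$. For $2\le t\le m$, $T_{m,t,k}$ is the $k$-uniform hypertree consisting of $t$ loose paths sharing exactly one common end vertex (and otherwise vertex-disjoint), of which $t-(m-t\lfloor m/t\rfloor)$ have length $\lfloor m/t\rfloor$ and $m-t\lfloor m/t\rfloor$ have length $\lfloor m/t\rfloor+1$; here a loose path of length $\ell$ is $(w_0,f_1,w_1,\dots,f_\ell,w_\ell)$ where each $f_i$ consists of $w_{i-1},w_i$ and $k-2$ further vertices, all vertices distinct except as stated. In particular $T_{m,2,k}$ is the loose path with $m$ edges. *)

theory Defs
  imports Complex_Main
begin

type_synonym 'a hgraph = "'a set \<times> 'a set set"

definition verts :: "'a hgraph \<Rightarrow> 'a set" where "verts H = fst H"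
definition edges :: "'a hgraph \<Rightarrow> 'a set set" where "edges H = snd H"

definition hypergraph :: "'a hgraph \<Rightarrow> bool" where
  "hypergraph H \<longleftrightarrow> finite (verts H) \<and> (\<forall>e\<in>edges H. e \<subseteq> verts H \<and> e \<noteq> {})"

definition uniform :: "nat \<Rightarrow> 'a hgraph \<Rightarrow> bool" where
  "uniform k H \<longleftrightarrow> hypergraph H \<and> (\<forall>e\<in>edges H. card e = k)"

definition degree :: "'a hgraph \<Rightarrow> 'a \<Rightarrow> nat" where
  "degree H v = card {e\<in>edges H. v \<in> e}"

definition is_path :: "'a hgraph \<Rightarrow> 'a list \<Rightarrow> 'a set list \<Rightarrow> bool" where
  "is_path H vs es \<longleftrightarrow> length vs = Suc (length es) \<and> distinct vs \<and> distinct es \<and>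
     set vs \<subseteq> verts H \<and> set es \<subseteq> edges H \<and>
     (\<forall>i<length es. vs ! i \<in> es ! i \<and> vs ! Suc i \<in> es ! i)"

definition is_cycle :: "'a hgraph \<Rightarrow> 'a list \<Rightarrow> 'a set list \<Rightarrow> bool" where
  "is_cycle H vs es \<longleftrightarrow> length vs = Suc (length es) \<and> length es \<ge> 2 \<and>
     distinct (tl vs) \<and> hd vs = last vs \<and> distinct es \<and>
     set vs \<subseteq> verts H \<and> set es \<subseteq> edges H \<and>
     (\<forall>i<length es. vs ! i \<in> es ! i \<and> vs ! Suc i \<in> es ! i)"

definition connected_hg :: "'a hgraph \<Rightarrow> bool" where
  "connected_hg H \<longleftrightarrow> (\<forall>u\<in>verts H. \<forall>v\<in>verts H. \<exists>vs es. is_path H vs es \<and> hd vs = u \<and> last vs = v)"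

definition hypertree :: "'a hgraph \<Rightarrow> bool" where
  "hypertree H \<longleftrightarrow> hypergraph H \<and> connected_hg H \<and> \<not> (\<exists>vs es. is_cycle H vs es)"

definition pendant_edge :: "'a hgraph \<Rightarrow> 'a set \<Rightarrow> bool" where
  "pendant_edge H e \<longleftrightarrow> e \<in> edges H \<and>
     (\<exists>v0\<in>e. degree H v0 \<ge> 2 \<and> (\<forall>u\<in>e - {v0}. degree H u = 1))"

definition hg_iso :: "'a hgraph \<Rightarrow> 'b hgraph \<Rightarrow> bool" where
  "hg_iso G H \<longleftrightarrow> (\<exists>f. bij_betw f (verts G) (verts H) \<and> (\<lambda>e. f ` e) ` edges G = edges H)"

text \<open>Order-k tensors indexed by vertices: entry at (i_1,...,i_k) is T [i_1,...,i_k].\<close>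
type_synonym 'a tensor = "'a list \<Rightarrow> real"

definition tensor_apply :: "nat \<Rightarrow> 'a set \<Rightarrow> 'a tensor \<Rightarrow> ('a \<Rightarrow> complex) \<Rightarrow> 'a \<Rightarrow> complex" where
  "tensor_apply k V T x i =
     (\<Sum>l\<in>{l. set l \<subseteq> V \<and> length l = k - 1}. complex_of_real (T (i # l)) * prod_list (map x l))"

definition tensor_eigenvalue :: "nat \<Rightarrow> 'a set \<Rightarrow> 'a tensor \<Rightarrow> complex \<Rightarrow> bool" where
  "tensor_eigenvalue k V T mu \<longleftrightarrow>
     (\<exists>x. (\<exists>v\<in>V. x v \<noteq> 0) \<and> (\<forall>i\<in>V. tensor_apply k V T x i = mu * x i ^ (k - 1)))"

definition tensor_spectral_radius :: "nat \<Rightarrow> 'a set \<Rightarrow> 'a tensor \<Rightarrow> real" where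
  "tensor_spectral_radius k V T = Sup {cmod mu | mu. tensor_eigenvalue k V T mu}"

definition adj_tensor :: "nat \<Rightarrow> 'a hgraph \<Rightarrow> 'a tensor" where
  "adj_tensor k H l = (if length l = k \<and> set l \<in> edges H then 1 / fact (k - 1) else 0)"

definition deg_tensor :: "nat \<Rightarrow> 'a hgraph \<Rightarrow> 'a tensor" where
  "deg_tensor k H l = (if length l = k \<and> l \<noteq> [] \<and> (\<forall>j\<in>set l. j = hd l)
                        then real (degree H (hd l)) else 0)"

definition A_alpha :: "nat \<Rightarrow> real \<Rightarrow> 'a hgraph \<Rightarrow> 'a tensor" where
  "A_alpha k \<alpha> H l = \<alpha> * deg_tensor k H l + (1 - \<alpha>) * adj_tensor k H l"

definition rho_alpha :: "nat \<Rightarrow> real \<Rightarrow> 'a hgraph \<Rightarrow> real" where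
  "rho_alpha k \<alpha> H = tensor_spectral_radius k (verts H) (A_alpha k \<alpha> H)"

text \<open>The hypertree T_{m,t,k}: centre (0,0,0); branch j (1..t) has length Tlen m t j;
  edge i of branch j is {w_{j,i-1}, w_{j,i}} plus k-2 further vertices, where
  w_{j,0} = centre, w_{j,i} = (j,i,0), and the extra vertices are (j,i,r), 1 <= r <= k-2.\<close>
definition Tlen :: "nat \<Rightarrow> nat \<Rightarrow> nat \<Rightarrow> nat" where
  "Tlen m t j = m div t + (if j \<le> m mod t then 1 else 0)"

definition Tedge :: "nat \<Rightarrow> nat \<Rightarrow> nat \<Rightarrow> (nat \<times> nat \<times> nat) set" where
  "Tedge k j i = (if i = 1 then {(0,0,0)} else {(j, i - 1, 0)}) \<union> {(j, i, r) | r. r \<le> k - 2}"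

definition Tedges :: "nat \<Rightarrow> nat \<Rightarrow> nat \<Rightarrow> (nat \<times> nat \<times> nat) set set" where
  "Tedges m t k = {Tedge k j i | j i. 1 \<le> j \<and> j \<le> t \<and> 1 \<le> i \<and> i \<le> Tlen m t j}"

definition T_mtk :: "nat \<Rightarrow> nat \<Rightarrow> nat \<Rightarrow> (nat \<times> nat \<times> nat) hgraph" where
  "T_mtk m t k = (insert (0,0,0) (\<Union> (Tedges m t k)), Tedges m t k)"

end

theory Submission
  imports Defs "HOL-Analysis.Function_Topology" "HOL-Combinatorics.Multiset_Permutations"
    "HOL-Combinatorics.List_Permutation"
begin

text \<open>A positive vector $x$ with $\mathcal A_\alpha(H)x=\mu x^{[k-1]}$ exists on every connected uniform
  hypergraph, and then $\rho_\alpha(H)=\mu$. Put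
  $g(v,e)=(1-\alpha)\prod_{u\in e}x_u/x_v^k$; then $\sum_{e\ni v}(\alpha+g(v,e))=\mu$ at every vertex and
  $\prod_{v\in e}g(v,e)=(1-\alpha)^k$ on every edge. For a pendant path these equations are a recursion:
  the value $s_n$ of $\alpha+g$ at the first edge of a path of length $n$ satisfies
  $s_{n+1}=\alpha+c/(\mu-\alpha-s_n)$, and a spider is described by the sum of the values $s_n$ of its legs.

  Let $\mu=\rho_\alpha(G)\ge\rho_\alpha(T_{m,t,k})$ and root $G$ at a maximal entry of $x$. The value of an edge is
  a convex function of the values hanging below it, whose derivative with respect to the value at $u$,
  transported to the root, is $(x_u/x_{root})^k\le1$. Hence cutting $G$ into $t$ descending paths and
  moving all of them to the root does not decrease the sum at the root, and increases it unless $G$ is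
  already a spider. Balancing the legs of a spider does not decrease the sum either, and for
  $T_{m,t,k}$ it is at most $\rho_\alpha(T_{m,t,k})$. So all these inequalities are equalities.\<close>

section \<open>The operator and its positive eigenvectors\<close>

text \<open>Both hypergraphs are evaluated at one and the same value \<mu>, that of
  \<open>G\<close>. With L = \<mu> - \<alpha>, a vertex of degree 1 has g = L, so an edge of a path,
  with inner end v and outer end w, satisfies g(v,e) g(w,e) L^(k-2) = (1-\<alpha>)^k; this is the
  origin of c = (1-\<alpha>)^k / L^(k-2). The obstacle is that at a prescribed \<mu> the recursion
  may break down, since L - s_n need not be positive. For the legs of \<open>T_mtk m t k\<close> the
  eigenvector of that hypertree provides bounds, because its eigenvalue is at most \<mu>; for other
  leg lengths positivity is recovered by undoing balancing moves one at a time. The derivative of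
  g(v,e) with respect to the value at u is g(v,e)/g(u,e) = (x_u/x_v)^k, and such factors telescope
  on the way to the root. Rooting at a maximal entry is what bounds the result by 1, and it also
  gives the root degree at least 2, so that the descending paths end in exactly the pendant
  edges.\<close>

definition nbsum :: "'a set set \<Rightarrow> ('a \<Rightarrow> 'b::comm_semiring_1) \<Rightarrow> 'a \<Rightarrow> 'b" where
  "nbsum E x i = (\<Sum>e\<in>{e\<in>E. i \<in> e}. \<Prod>u\<in>e - {i}. x u)"

text \<open>A list \<open>i # l\<close> whose set is an edge has as many entries as the edge has
  vertices, so \<open>l\<close> is an ordering of the other vertices; the (k-1)! orderings cancel
  the normalisation of the adjacency tensor. Only the constant list meets the diagonal tensor. The
  scalars are generic because eigenvalues are complex while positive eigenvectors are real.\<close>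

lemma tensor_apply_A_alpha:
  assumes "uniform k H" "k \<ge> 2" "i \<in> verts H"
  shows "tensor_apply k (verts H) (A_alpha k \<alpha> H) x i =
    of_real \<alpha> * of_nat (degree H i) * x i ^ (k - 1) + of_real (1 - \<alpha>) * nbsum (edges H) x i"
proof -
  define V E where "V = verts H" and "E = edges H"
  have finV: "finite V" and EV: "\<And>e. e \<in> E \<Longrightarrow> e \<subseteq> V" and cardE: "\<And>e. e \<in> E \<Longrightarrow> card e = k"
    using assms(1) by (auto simp: V_def E_def uniform_def hypergraph_def)
  have finE: "finite E" using finV EV by (meson PowI finite_Pow_iff finite_subset subsetI)
  have fine: "finite e" if "e \<in> E" for e using EV[OF that] finV finite_subset by blast
  define Ls where "Ls = {l. set l \<subseteq> V \<and> length l = k - 1}"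
  have finL: "finite Ls" unfolding Ls_def using finV by (rule finite_lists_length_eq)
  define p where "p l = prod_list (map x l)" for l
  have "tensor_apply k V (A_alpha k \<alpha> H) x i =
     (\<Sum>l\<in>Ls. of_real \<alpha> * (of_real (deg_tensor k H (i # l)) * p l)
             + of_real (1 - \<alpha>) * (of_real (adj_tensor k H (i # l)) * p l))"
    unfolding tensor_apply_def Ls_def p_def A_alpha_def by (simp add: algebra_simps)
  also have "\<dots> = of_real \<alpha> * (\<Sum>l\<in>Ls. of_real (deg_tensor k H (i # l)) * p l)
      + of_real (1 - \<alpha>) * (\<Sum>l\<in>Ls. of_real (adj_tensor k H (i # l)) * p l)"
    by (simp add: sum.distrib sum_distrib_left)
  also have "(\<Sum>l\<in>Ls. of_real (deg_tensor k H (i # l)) * p l) = of_nat (degree H i) * x i ^ (k - 1)"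
  proof -
    have "(\<Sum>l\<in>Ls. of_real (deg_tensor k H (i # l)) * p l) =
          (\<Sum>l\<in>Ls. if l = replicate (k - 1) i then of_nat (degree H i) * x i ^ (k - 1) else 0)"
    proof (rule sum.cong[OF refl])
      fix l assume l: "l \<in> Ls"
      have "(\<forall>j\<in>set l. j = i) \<longleftrightarrow> l = replicate (k - 1) i"
        using l by (auto simp: Ls_def intro: replicate_eqI)
      moreover have "p (replicate (k - 1) i) = x i ^ (k - 1)"
        unfolding p_def by simp
      ultimately show "of_real (deg_tensor k H (i # l)) * p l =
          (if l = replicate (k - 1) i then of_nat (degree H i) * x i ^ (k - 1) else 0)"
        using l assms(2) unfolding deg_tensor_def Ls_def by auto
    qed
    also have "\<dots> = of_nat (degree H i) * x i ^ (k - 1)"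
      using finL assms(3) by (subst sum.delta) (auto simp: Ls_def V_def)
    finally show ?thesis .
  qed
  also have "(\<Sum>l\<in>Ls. of_real (adj_tensor k H (i # l)) * p l) = nbsum E x i"
  proof -
    define A where "A = (\<Union>e\<in>{e\<in>E. i \<in> e}. permutations_of_set (e - {i}))"
    have Aeq: "{l\<in>Ls. set (i # l) \<in> E} = A"
    proof (intro equalityI subsetI)
      fix l assume "l \<in> {l\<in>Ls. set (i # l) \<in> E}"
      then have l: "length l = k - 1" "set (i # l) \<in> E" by (auto simp: Ls_def)
      have "card (set (i # l)) = length (i # l)" using cardE[OF l(2)] l(1) assms(2) by simp
      then have "distinct (i # l)" by (rule card_distinct)
      then have "l \<in> permutations_of_set (set (i # l) - {i})" by (auto simp: permutations_of_set_def)
      then show "l \<in> A" using l(2) unfolding A_def by auto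
    next
      fix l assume "l \<in> A"
      then obtain e where e: "e \<in> E" "i \<in> e" "l \<in> permutations_of_set (e - {i})"
        unfolding A_def by auto
      then have "length l = k - 1" "set (i # l) = e" "set l \<subseteq> V"
        using cardE[OF e(1)] EV[OF e(1)] fine[OF e(1)] length_finite_permutations_of_set[OF e(3)]
        by (auto simp: permutations_of_set_def)
      then show "l \<in> {l\<in>Ls. set (i # l) \<in> E}" using e by (auto simp: Ls_def)
    qed
    have "(\<Sum>l\<in>Ls. of_real (adj_tensor k H (i # l)) * p l) = (\<Sum>l\<in>{l\<in>Ls. set (i # l) \<in> E}. p l / fact (k - 1))"
      using finL assms(2) by (intro sum.mono_neutral_cong_right)
        (auto simp: adj_tensor_def Ls_def E_def)
    also have "\<dots> = (\<Sum>e\<in>{e\<in>E. i \<in> e}. \<Sum>l\<in>permutations_of_set (e - {i}). p l / fact (k - 1))"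
      unfolding Aeq A_def
    proof (rule sum.UNION_disjoint)
      show "finite {e \<in> E. i \<in> e}" using finE by simp
    next
      show "\<forall>e\<in>{e \<in> E. i \<in> e}. finite (permutations_of_set (e - {i}))" by simp
    next
      show "\<forall>e\<in>{e \<in> E. i \<in> e}. \<forall>e'\<in>{e \<in> E. i \<in> e}. e \<noteq> e' \<longrightarrow>
        permutations_of_set (e - {i}) \<inter> permutations_of_set (e' - {i}) = {}"
        by (auto simp: permutations_of_set_def)
    qed
    also have "\<dots> = nbsum E x i"
      unfolding nbsum_def
    proof (rule sum.cong[OF refl])
      fix e assume e: "e \<in> {e\<in>E. i \<in> e}"
      have fe: "finite (e - {i})" using e fine by auto
      have "(\<Sum>l\<in>permutations_of_set (e - {i}). p l / fact (k - 1))
          = (\<Sum>l\<in>permutations_of_set (e - {i}). (\<Prod>u\<in>e - {i}. x u) / fact (k - 1))"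
        by (intro sum.cong refl) (metis p_def permutations_of_setD prod.distinct_set_conv_list)
      also have "\<dots> = (\<Prod>u\<in>e - {i}. x u)"
        using e fe cardE by simp
      finally show "(\<Sum>l\<in>permutations_of_set (e - {i}). p l / fact (k - 1)) = (\<Prod>u\<in>e - {i}. x u)" .
    qed
    finally show ?thesis .
  qed
  finally show ?thesis by (simp add: V_def E_def)
qed

definition positive_eigenvector :: "nat \<Rightarrow> real \<Rightarrow> 'a hgraph \<Rightarrow> real \<Rightarrow> ('a \<Rightarrow> real) \<Rightarrow> bool" where
  "positive_eigenvector k \<alpha> H \<mu> x \<longleftrightarrow> (\<forall>v\<in>verts H. 0 < x v \<and>
     \<alpha> * real (degree H v) * x v ^ (k - 1) + (1 - \<alpha>) * nbsum (edges H) x v = \<mu> * x v ^ (k - 1))"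

text \<open>Perron-Frobenius comparison: a complex eigenvector \<open>y\<close> is measured against
  \<open>x\<close> at a vertex where |y|/x attains its maximum r. There the neighbour sum of
  \<open>y\<close> is at most r^(k-1) times that of \<open>x\<close>.\<close>

theorem rho_alpha_eq_positive_eigenvalue:
  assumes H: "uniform k H" "k \<ge> 2" "verts H \<noteq> {}" and \<alpha>: "0 \<le> \<alpha>" "\<alpha> < 1"
    and x: "positive_eigenvector k \<alpha> H \<mu> x"
  shows "rho_alpha k \<alpha> H = \<mu>"
proof -
  define V E where "V = verts H" and "E = edges H"
  have finV: "finite V" and EV: "\<And>e. e \<in> E \<Longrightarrow> e \<subseteq> V" and cardE: "\<And>e. e \<in> E \<Longrightarrow> card e = k"
    using H(1) by (auto simp: V_def E_def uniform_def hypergraph_def)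
  have xpos: "0 < x v" and xeq: "\<alpha> * real (degree H v) * x v ^ (k - 1) + (1 - \<alpha>) * nbsum E x v = \<mu> * x v ^ (k - 1)"
    if "v \<in> V" for v using x that by (auto simp: positive_eigenvector_def V_def E_def)
  have nbnn: "0 \<le> nbsum E x v" if "v \<in> V" for v
    unfolding nbsum_def using EV xpos by (intro sum_nonneg prod_nonneg) force
  obtain v0 where v0: "v0 \<in> V" using H(3) V_def by auto
  have "0 \<le> \<mu> * x v0 ^ (k - 1)"
    using \<alpha> nbnn[OF v0] xpos[OF v0] by (subst xeq[OF v0, symmetric]) auto
  then have \<mu>nn: "0 \<le> \<mu>" using zero_less_power[OF xpos[OF v0], of "k - 1"]
    by (simp add: zero_le_mult_iff)
  have ev: "tensor_eigenvalue k V (A_alpha k \<alpha> H) (of_real \<mu>)"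
    unfolding tensor_eigenvalue_def
  proof (intro exI[of _ "\<lambda>v. of_real (x v)"] conjI ballI)
    show "\<exists>v\<in>V. complex_of_real (x v) \<noteq> 0" using v0 xpos by force
  next
    fix i assume i: "i \<in> V"
    have "nbsum E (\<lambda>v. complex_of_real (x v)) i = of_real (nbsum E x i)"
      by (simp add: nbsum_def)
    then have "tensor_apply k V (A_alpha k \<alpha> H) (\<lambda>v. complex_of_real (x v)) i =
      of_real (\<alpha> * real (degree H i) * x i ^ (k - 1) + (1 - \<alpha>) * nbsum E x i)"
      using tensor_apply_A_alpha[OF H(1,2), of i] i by (simp add: V_def E_def)
    then show "tensor_apply k V (A_alpha k \<alpha> H) (\<lambda>v. complex_of_real (x v)) i =
      complex_of_real \<mu> * complex_of_real (x i) ^ (k - 1)"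
      unfolding xeq[OF i] by simp
  qed
  have bound: "cmod \<nu> \<le> \<mu>" if nu: "tensor_eigenvalue k V (A_alpha k \<alpha> H) \<nu>" for \<nu>
  proof -
    obtain y where y: "\<exists>v\<in>V. y v \<noteq> 0"
      and yeq: "\<And>i. i \<in> V \<Longrightarrow> tensor_apply k V (A_alpha k \<alpha> H) y i = \<nu> * y i ^ (k - 1)"
      using nu unfolding tensor_eigenvalue_def by blast
    define q where "q v = cmod (y v) / x v" for v
    define r where "r = Max (q ` V)"
    have rge: "q v \<le> r" if "v \<in> V" for v using that finV unfolding r_def by auto
    have "r \<in> q ` V" unfolding r_def using finV v0 by (intro Max_in) auto
    then obtain v where v: "v \<in> V" "r = q v" by auto
    have yle: "cmod (y u) \<le> r * x u" if "u \<in> V" for u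
      using rge[OF that] xpos[OF that] by (simp add: q_def field_simps)
    have yv: "cmod (y v) = r * x v" using v xpos[OF v(1)] by (simp add: q_def)
    obtain w where w: "w \<in> V" "y w \<noteq> 0" using y by auto
    have "0 < q w" using w xpos[OF w(1)] by (simp add: q_def)
    then have rpos: "0 < r" using rge[OF w(1)] by linarith
    define d where "d = real (degree H v)"
    \<comment> \<open>The diagonal part goes to the left before moduli are taken. The estimate
      concerns \<nu> - \<alpha> d; since \<alpha> d is nonnegative, the triangle inequality returns
      a bound on \<nu> itself.\<close>
    have eq: "(\<nu> - of_real (\<alpha> * d)) * y v ^ (k - 1) = of_real (1 - \<alpha>) * nbsum E y v"
      using yeq[OF v(1)] tensor_apply_A_alpha[OF H(1,2), of v \<alpha> y] v(1)
      by (simp add: V_def E_def d_def algebra_simps)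
    have "cmod (nbsum E y v) \<le> (\<Sum>e\<in>{e\<in>E. v \<in> e}. \<Prod>u\<in>e - {v}. r * x u)"
      unfolding nbsum_def
    proof (rule order_trans[OF norm_sum], rule sum_mono)
      fix e assume e: "e \<in> {e\<in>E. v \<in> e}"
      show "cmod (\<Prod>u\<in>e - {v}. y u) \<le> (\<Prod>u\<in>e - {v}. r * x u)"
        unfolding prod_norm[symmetric] using e EV yle by (intro prod_mono) auto
    qed
    also have "\<dots> = (\<Sum>e\<in>{e\<in>E. v \<in> e}. r ^ (k - 1) * (\<Prod>u\<in>e - {v}. x u))"
    proof (rule sum.cong[OF refl])
      fix e assume e: "e \<in> {e\<in>E. v \<in> e}"
      have "card (e - {v}) = k - 1" using e cardE[of e] by (simp add: card_Diff_singleton)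
      then show "(\<Prod>u\<in>e - {v}. r * x u) = r ^ (k - 1) * (\<Prod>u\<in>e - {v}. x u)"
        by (simp add: prod.distrib)
    qed
    also have "\<dots> = r ^ (k - 1) * nbsum E x v" by (simp add: nbsum_def sum_distrib_left)
    finally have nb: "cmod (nbsum E y v) \<le> r ^ (k - 1) * nbsum E x v" .
    have "cmod (\<nu> - of_real (\<alpha> * d)) * (r * x v) ^ (k - 1) = (1 - \<alpha>) * cmod (nbsum E y v)"
    proof -
      have "cmod (of_real (1 - \<alpha>)) = 1 - \<alpha>" using \<alpha> by (simp only: norm_of_real)
      then show ?thesis using arg_cong[OF eq, of cmod] yv by (simp only: norm_mult norm_power)
    qed
    also have "\<dots> \<le> (1 - \<alpha>) * (r ^ (k - 1) * nbsum E x v)" using nb \<alpha> by (intro mult_left_mono) auto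
    also have "\<dots> = r ^ (k - 1) * ((\<mu> - \<alpha> * d) * x v ^ (k - 1))"
    proof -
      have "(1 - \<alpha>) * nbsum E x v = (\<mu> - \<alpha> * d) * x v ^ (k - 1)"
        using xeq[OF v(1)] by (simp add: d_def algebra_simps)
      then show ?thesis by (metis mult.left_commute)
    qed
    also have "\<dots> = (\<mu> - \<alpha> * d) * (r * x v) ^ (k - 1)" by (simp add: power_mult_distrib)
    finally have "cmod (\<nu> - of_real (\<alpha> * d)) \<le> \<mu> - \<alpha> * d"
      using rpos xpos[OF v(1)] by simp
    moreover have "cmod \<nu> \<le> cmod (\<nu> - of_real (\<alpha> * d)) + cmod (of_real (\<alpha> * d))"
      by (metis diff_add_cancel norm_triangle_ineq)
    moreover have "cmod (of_real (\<alpha> * d)) = \<alpha> * d" using \<alpha> by (simp add: d_def norm_mult)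
    ultimately show ?thesis by linarith
  qed
  have "Sup {cmod \<nu> |\<nu>. tensor_eigenvalue k V (A_alpha k \<alpha> H) \<nu>} = \<mu>"
  proof (rule cSup_eq_maximum)
    show "\<mu> \<in> {cmod \<nu> |\<nu>. tensor_eigenvalue k V (A_alpha k \<alpha> H) \<nu>}"
      using ev \<mu>nn by (metis (mono_tags, lifting) mem_Collect_eq norm_of_real abs_of_nonneg)
  qed (use bound in auto)
  then show ?thesis unfolding rho_alpha_def tensor_spectral_radius_def V_def .
qed

section \<open>Existence of a positive eigenvector\<close>

text \<open>Connectivity in the form in which it is used: some edge leads out of every proper
  nonempty set of vertices. It spreads estimates over all vertices, enlarges subtrees, and can be
  checked for \<open>T_mtk\<close> without writing down paths.\<close>

definition cut_connected :: "'a hgraph \<Rightarrow> bool" where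
  "cut_connected H \<longleftrightarrow> (\<forall>A. A \<subseteq> verts H \<and> A \<noteq> {} \<and> A \<noteq> verts H \<longrightarrow>
     (\<exists>e\<in>edges H. e \<inter> A \<noteq> {} \<and> e \<inter> (verts H - A) \<noteq> {}))"

lemma connected_hg_imp_cut_connected:
  assumes "connected_hg H"
  shows "cut_connected H"
  unfolding cut_connected_def
proof (intro allI impI)
  fix A assume A: "A \<subseteq> verts H \<and> A \<noteq> {} \<and> A \<noteq> verts H"
  then obtain u w where u: "u \<in> A" and w: "w \<in> verts H" "w \<notin> A" by blast
  then obtain vs es where p: "is_path H vs es" "hd vs = u" "last vs = w"
    using assms A unfolding connected_hg_def by blast
  have len: "length vs = Suc (length es)" and sub: "set vs \<subseteq> verts H" and es: "set es \<subseteq> edges H"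
    and inc: "\<And>i. i < length es \<Longrightarrow> vs ! i \<in> es ! i \<and> vs ! Suc i \<in> es ! i"
    using p(1) by (auto simp: is_path_def)
  have "vs \<noteq> []" using len by auto
  then have h: "vs ! 0 = u" "vs ! length es = w" using p len by (auto simp: hd_conv_nth last_conv_nth)
  have "\<exists>i<length es. vs ! i \<in> A \<and> vs ! Suc i \<notin> A"
  proof (rule ccontr)
    assume c: "\<not> ?thesis"
    have "i \<le> length es \<Longrightarrow> vs ! i \<in> A" for i
      by (induction i) (use h u c in \<open>auto simp: Suc_le_eq\<close>)
    then show False using h w by auto
  qed
  then obtain i where i: "i < length es" "vs ! i \<in> A" "vs ! Suc i \<notin> A" by blast
  moreover have "vs ! Suc i \<in> verts H" using i len sub by (auto intro: nth_mem)
  ultimately show "\<exists>e\<in>edges H. e \<inter> A \<noteq> {} \<and> e \<inter> (verts H - A) \<noteq> {}"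
    using inc[OF i(1)] es by (intro bexI[of _ "es ! i"]) auto
qed

text \<open>A minimal $\mu$ for which some positive $x$ satisfies $\mathcal A_\alpha x\le\mu x^{[k-1]}$ exists by
  compactness, since connectivity bounds the ratios of the entries of such an $x$. At the minimal value
  no vertex has slack: lowering the entry of a vertex with slack creates slack at its neighbours.\<close>
theorem positive_eigenvector_exists:
  assumes H: "uniform k H" "k \<ge> 2" "verts H \<noteq> {}" "cut_connected H" and \<alpha>: "0 \<le> \<alpha>" "\<alpha> < 1"
  obtains \<mu> x where "positive_eigenvector k \<alpha> H \<mu> x"
proof -
  define V E where "V = verts H" and "E = edges H"
  have finV: "finite V" and EV: "\<And>e. e \<in> E \<Longrightarrow> e \<subseteq> V" and cardE: "\<And>e. e \<in> E \<Longrightarrow> card e = k"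
    using H(1) by (auto simp: V_def E_def uniform_def hypergraph_def)
  have finE: "finite E" using finV EV by (meson PowI finite_Pow_iff finite_subset subsetI)
  have fine: "finite e" if "e \<in> E" for e using EV[OF that] finV finite_subset by blast
  have Vne: "V \<noteq> {}" using H(3) V_def by simp
  have cut: "\<exists>e\<in>E. e \<inter> A \<noteq> {} \<and> e \<inter> (V - A) \<noteq> {}" if "A \<subseteq> V" "A \<noteq> {}" "A \<noteq> V" for A
    using H(4) that unfolding cut_connected_def V_def E_def by blast
  define F where "F x v = \<alpha> * real (degree H v) * x v ^ (k - 1) + (1 - \<alpha>) * nbsum E x v" for x v
  define sub where "sub x l \<longleftrightarrow> (\<forall>v\<in>V. 0 < x v \<and> F x v \<le> l * x v ^ (k - 1))" for x :: "'a \<Rightarrow> real" and l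
  have nb_mono: "nbsum E x v \<le> nbsum E y v" if "\<And>u. u \<in> V \<Longrightarrow> u \<noteq> v \<Longrightarrow> 0 \<le> x u \<and> x u \<le> y u"
    for x y :: "'a \<Rightarrow> real" and v
    unfolding nbsum_def using EV that by (intro sum_mono prod_mono) blast
  have nb_pos: "0 \<le> nbsum E x v" if "\<And>u. u \<in> V \<Longrightarrow> 0 < x u" for x :: "'a \<Rightarrow> real" and v
    unfolding nbsum_def using EV that by (intro sum_nonneg prod_nonneg) force
  have F_ge: "(1 - \<alpha>) * (\<Prod>u\<in>e - {v}. x u) \<le> F x v" if "e \<in> E" "v \<in> e" "\<And>u. u \<in> V \<Longrightarrow> 0 < x u"
    for x :: "'a \<Rightarrow> real" and v e
  proof -
    have "(\<Prod>u\<in>e - {v}. x u) \<le> nbsum E x v"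
      unfolding nbsum_def using finE EV that
      by (intro member_le_sum[of e "{e\<in>E. v \<in> e}" "\<lambda>e. \<Prod>u\<in>e - {v}. x u"] prod_nonneg) force+
    moreover have "0 \<le> \<alpha> * real (degree H v) * x v ^ (k - 1)"
      using \<alpha> that EV[OF that(1)] by (intro mult_nonneg_nonneg) (auto intro!: zero_le_power less_imp_le)
    ultimately show ?thesis unfolding F_def using \<alpha> by (smt (verit) mult_left_mono)
  qed
  have F_nonneg: "0 \<le> F x v" if "\<And>u. u \<in> V \<Longrightarrow> 0 < x u" "v \<in> V" for x v
    unfolding F_def using \<alpha> that nb_pos[OF that(1)]
    by (intro add_nonneg_nonneg mult_nonneg_nonneg) (auto intro!: zero_le_power less_imp_le)
  \<comment> \<open>Degrees are at most \<open>card E\<close>, so the constant vector 1 is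
    admissible with this value, and only values up to \<Lambda> compete for the minimum.\<close>
  define \<Lambda> where "\<Lambda> = real (card E)"
  have one: "sub (\<lambda>_. 1) \<Lambda>"
  proof -
    have "F (\<lambda>_. 1) v = real (degree H v)" for v
      unfolding F_def nbsum_def degree_def E_def by (simp add: algebra_simps)
    moreover have "degree H v \<le> card E" for v
      unfolding degree_def E_def[symmetric] using finE by (intro card_mono) auto
    ultimately show ?thesis by (simp add: sub_def \<Lambda>_def)
  qed
  \<comment> \<open>At the smallest entry x_w of an edge the inequality gives (1-\<alpha>) x_u
    x_w^(k-2) <= \<Lambda> x_w^(k-1) for every other vertex u of the edge. The summand 1 keeps the
    denominator positive when there are no edges.\<close>
  define \<kappa> where "\<kappa> = (1 - \<alpha>) / (\<Lambda> + 1)"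
  have \<kappa>: "0 < \<kappa>" "\<kappa> \<le> 1" using \<alpha> by (auto simp: \<kappa>_def \<Lambda>_def)
  have harnack: "\<kappa> * x u \<le> x w" if s: "sub x l" "l \<le> \<Lambda>" and e: "e \<in> E" "u \<in> e" "w \<in> e" for x l e u w
  proof -
    have xpos: "0 < x v" if "v \<in> V" for v using s that by (auto simp: sub_def)
    obtain w0 where w0: "w0 \<in> e" "\<And>v. v \<in> e \<Longrightarrow> x w0 \<le> x v"
      using fine[OF e(1)] e(2) by (metis arg_min_if_finite(1) arg_min_least empty_iff)
    have w0V: "w0 \<in> V" and uV: "u \<in> V" using EV e w0 by auto
    have "\<kappa> * x u \<le> x w0"
    proof (cases "u = w0")
      case True
      then show ?thesis using \<kappa> xpos[OF w0V] by simp
    next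
      case False
      have "x w0 ^ (k - 2) = (\<Prod>v\<in>e - {w0} - {u}. x w0)"
        using False w0 e cardE[OF e(1)] fine[OF e(1)] H(2)
        by (simp add: card_Diff_singleton_if numeral_2_eq_2)
      also have "\<dots> \<le> (\<Prod>v\<in>e - {w0} - {u}. x v)"
        using w0 xpos[OF w0V] by (intro prod_mono) auto
      finally have "x u * x w0 ^ (k - 2) \<le> x u * (\<Prod>v\<in>e - {w0} - {u}. x v)"
        using xpos[OF uV] by simp
      also have "\<dots> = (\<Prod>v\<in>e - {w0}. x v)"
        using False e fine by (subst prod.remove[of "e - {w0}" u]) auto
      finally have "(1 - \<alpha>) * (x u * x w0 ^ (k - 2)) \<le> (1 - \<alpha>) * (\<Prod>v\<in>e - {w0}. x v)"
        using \<alpha> by simp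
      also have "\<dots> \<le> F x w0" using F_ge[OF e(1) w0(1)] xpos by blast
      also have "\<dots> \<le> l * x w0 ^ (k - 1)" using s w0V by (auto simp: sub_def)
      also have "\<dots> \<le> (\<Lambda> + 1) * x w0 ^ (k - 1)" using s(2) xpos[OF w0V] by simp
      also have "\<dots> = (\<Lambda> + 1) * x w0 * x w0 ^ (k - 2)"
      proof -
        have "k - 1 = Suc (k - 2)" using H(2) by simp
        then show ?thesis by simp
      qed
      finally have "(1 - \<alpha>) * x u \<le> (\<Lambda> + 1) * x w0" using xpos[OF w0V] by simp
      then show ?thesis by (simp add: \<kappa>_def \<Lambda>_def field_simps)
    qed
    also have "\<dots> \<le> x w" using w0 e by blast
    finally show ?thesis .
  qed
  define N where "N = card V"
  have lower: "\<kappa> ^ N * x u \<le> x v" if s: "sub x l" "l \<le> \<Lambda>" and uv: "u \<in> V" "v \<in> V" for x l u v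
  proof -
    have xpos: "0 < x v" if "v \<in> V" for v using s that by (auto simp: sub_def)
    \<comment> \<open>A set of vertices whose entries are at least \<kappa>^n x_u gains a vertex
      through an edge leaving it, at the cost of one more factor \<kappa>; after \<open>N\<close>
      steps it is all of \<open>V\<close>.\<close>
    have "\<exists>A. A \<subseteq> V \<and> u \<in> A \<and> min (Suc n) N \<le> card A \<and> (\<forall>v\<in>A. \<kappa> ^ n * x u \<le> x v)" for n
    proof (induction n)
      case 0
      show ?case using uv by (intro exI[of _ "{u}"]) auto
    next
      case (Suc n)
      then obtain A where A: "A \<subseteq> V" "u \<in> A" "min (Suc n) N \<le> card A" "\<And>v. v \<in> A \<Longrightarrow> \<kappa> ^ n * x u \<le> x v"
        by blast
      have dec: "\<kappa> ^ Suc n * x u \<le> x v" if "v \<in> A" for v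
      proof -
        have "\<kappa> ^ Suc n * x u \<le> \<kappa> ^ n * x u"
          using \<kappa> xpos[OF uv(1)] by (simp add: mult_le_cancel_right2)
        then show ?thesis using A(4)[OF that] by linarith
      qed
      show ?case
      proof (cases "A = V")
        case True
        then show ?thesis using A dec by (intro exI[of _ A]) (auto simp: N_def)
      next
        case False
        have "A \<noteq> {}" using A(2) by blast
        then obtain e where e: "e \<in> E" "e \<inter> A \<noteq> {}" "e \<inter> (V - A) \<noteq> {}"
          using cut[OF A(1) _ False] by blast
        then obtain a b where ab: "a \<in> e" "a \<in> A" "b \<in> e" "b \<in> V" "b \<notin> A" by blast
        have "\<kappa> ^ Suc n * x u \<le> \<kappa> * x a" 
          using mult_left_mono[OF A(4)[OF ab(2)], of \<kappa>] \<kappa> by (simp only: power_Suc mult.assoc less_imp_le)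
        then have "\<kappa> ^ Suc n * x u \<le> x b" using harnack[OF s e(1) ab(1,3)] by linarith
        moreover have "card (insert b A) = Suc (card A)"
          using ab(5) finite_subset[OF A(1) finV] by simp
        moreover have "\<forall>v\<in>insert b A. \<kappa> ^ Suc n * x u \<le> x v" using dec calculation(1) by blast
        moreover have "insert b A \<subseteq> V" "u \<in> insert b A" using A ab by blast+
        moreover have "min (Suc (Suc n)) N \<le> Suc (card A)" using A(3) by linarith
        ultimately show ?thesis by (intro exI[of _ "insert b A"]) simp
      qed
    qed
    from this[of N] obtain A where A: "A \<subseteq> V" "N \<le> card A" "\<forall>v\<in>A. \<kappa> ^ N * x u \<le> x v"
      by (metis min_def nat_le_linear not_less_eq_eq)
    have "A = V" using A finV by (intro card_seteq) (auto simp: N_def)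
    then show ?thesis using A uv by auto
  qed
  \<comment> \<open>Coordinates outside \<open>V\<close> are frozen at 1, so \<open>K\<close> is
    compact in the space of all functions on a possibly infinite type. On \<open>V\<close> the lower
    bound is the ratio estimate for a vector with largest entry 1.\<close>
  define K where "K = PiE UNIV (\<lambda>v. if v \<in> V then {\<kappa> ^ N..1} else {1})"
  have "compactin (product_topology (\<lambda>i::'a. euclidean) UNIV) K"
    unfolding K_def by (subst compactin_PiE) auto
  then have compK: "compact K" by (simp add: euclidean_product_topology)
  define S where "S = ({0..\<Lambda>} \<times> K) \<inter> (\<Inter>v\<in>V. {p. F (snd p) v \<le> fst p * snd p v ^ (k - 1)})"
  have coord: "continuous_on UNIV (\<lambda>p::real \<times> ('a \<Rightarrow> real). snd p v)" for v
    by (rule continuous_on_product_then_coordinatewise[OF continuous_on_snd[OF continuous_on_id]])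
  have "closed {p::real \<times> ('a \<Rightarrow> real). F (snd p) v \<le> fst p * snd p v ^ (k - 1)}" for v
    unfolding F_def nbsum_def
    by (intro closed_Collect_le continuous_on_add continuous_on_mult continuous_on_power continuous_on_sum
        continuous_on_prod continuous_on_const coord continuous_on_fst continuous_on_id)
  then have compS: "compact S"
    unfolding S_def using compK by (intro compact_Int_closed compact_Times closed_INT) auto
  have KposV: "0 < x v" if "x \<in> K" "v \<in> V" for x v
  proof -
    have "\<kappa> ^ N \<le> x v" 
      using that PiE_mem[of x UNIV "\<lambda>v. if v \<in> V then {\<kappa> ^ N..1} else {1}" v] by (simp add: K_def)
    then show ?thesis using \<kappa>(1) zero_less_power[of \<kappa> N] by linarith
  qed
  have oneS: "(\<Lambda>, \<lambda>_. 1) \<in> S"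
    using one \<kappa> unfolding S_def K_def sub_def by (auto simp: \<Lambda>_def power_le_one)
  obtain p where p: "p \<in> S" "\<And>q. q \<in> S \<Longrightarrow> fst p \<le> fst q"
  proof -
    have "S \<noteq> {}" using oneS by blast
    then show thesis
      using continuous_attains_inf[OF compS _ continuous_on_fst[OF continuous_on_id]] that by blast
  qed
  define l where "l = fst p"
  have subl: "sub (snd p) l" and lnn: "0 \<le> l" and lle: "l \<le> \<Lambda>"
  proof -
    have "fst p \<in> {0..\<Lambda>}" "snd p \<in> K" "\<forall>v\<in>V. F (snd p) v \<le> fst p * snd p v ^ (k - 1)"
      using p(1) unfolding S_def by (auto simp only: mem_Times_iff Int_iff INT_iff mem_Collect_eq)
    then show "sub (snd p) l" "0 \<le> l" "l \<le> \<Lambda>" using KposV by (simp_all add: sub_def l_def)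
  qed
  have min: "l \<le> l'" if s: "sub x l'" for x l'
  proof (cases "l' \<le> \<Lambda>")
    case False
    then show ?thesis using lle by simp
  next
    case True
    have xpos: "0 < x v" if "v \<in> V" for v using s that by (auto simp: sub_def)
    define M where "M = Max (x ` V)"
    have "M \<in> x ` V" unfolding M_def using finV Vne by (intro Max_in) auto
    then obtain u where u: "u \<in> V" "M = x u" by auto
    have Mge: "x v \<le> M" if "v \<in> V" for v unfolding M_def using finV that by auto
    have Mpos: "0 < M" using u xpos by simp
    \<comment> \<open>Both sides of the inequality are homogeneous of degree k - 1, so scaling the
      largest entry to 1 keeps \<open>l'\<close> admissible and moves the vector into
      \<open>K\<close>.\<close>
    define y where "y v = (if v \<in> V then x v / M else 1)" for v
    have Fy: "F y v = F x v / M ^ (k - 1)" if "v \<in> V" for v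
    proof -
      have "nbsum E y v = (\<Sum>e\<in>{e\<in>E. v \<in> e}. (\<Prod>u\<in>e - {v}. x u) / M ^ (k - 1))"
        unfolding nbsum_def
      proof (rule sum.cong[OF refl])
        fix e assume e: "e \<in> {e\<in>E. v \<in> e}"
        have "(\<Prod>u\<in>e - {v}. y u) = (\<Prod>u\<in>e - {v}. x u / M)"
          using e EV by (intro prod.cong) (auto simp: y_def)
        moreover have "card (e - {v}) = k - 1" using e cardE[of e] by (simp add: card_Diff_singleton)
        ultimately show "(\<Prod>u\<in>e - {v}. y u) = (\<Prod>u\<in>e - {v}. x u) / M ^ (k - 1)"
          by (simp add: prod_dividef)
      qed
      then have "nbsum E y v = nbsum E x v / M ^ (k - 1)"
        by (simp add: nbsum_def sum_divide_distrib)
      then show ?thesis using that by (simp add: F_def y_def power_divide add_divide_distrib)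
    qed
    have "F y v \<le> l' * y v ^ (k - 1)" if v: "v \<in> V" for v
    proof -
      have "F x v / M ^ (k - 1) \<le> l' * x v ^ (k - 1) / M ^ (k - 1)"
        using s v Mpos by (intro divide_right_mono) (auto simp: sub_def)
      then show ?thesis using v by (simp add: Fy y_def power_divide)
    qed
    moreover have "0 \<le> l'"
    proof -
      have "0 \<le> l' * x u ^ (k - 1)"
        using F_nonneg[of x u] xpos u s by (force simp: sub_def)
      then show ?thesis using zero_less_power[OF xpos[OF u(1)], of "k - 1"] by (simp add: zero_le_mult_iff)
    qed
    moreover have "y \<in> K"
      using lower[OF s True u(1)] Mge Mpos u unfolding K_def y_def by (auto simp: field_simps)
    ultimately have "(l', y) \<in> S" using True by (auto simp: S_def)
    then show ?thesis using p(2) by (fastforce simp: l_def)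
  qed
  \<comment> \<open>Choosing a vector with the most slack vertices replaces an iteration: if some
    but not all vertices are slack, one more can be made slack, and if all are, \<open>l\<close> can
    be lowered.\<close>
  define Z where "Z x = {v\<in>V. F x v < l * x v ^ (k - 1)}" for x
  obtain x where x: "sub x l" and xmax: "\<And>y. sub y l \<Longrightarrow> card (Z y) \<le> card (Z x)"
  proof -
    have "\<forall>y. sub y l \<longrightarrow> card (Z y) < Suc (card V)"
      using finV by (auto simp: Z_def less_Suc_eq_le intro: card_mono)
    then have "\<exists>x. sub x l \<and> (\<forall>y. sub y l \<longrightarrow> card (Z y) \<le> card (Z x))"
      using ex_has_greatest_nat[of "\<lambda>y. sub y l" "snd p" "\<lambda>y. card (Z y)" "Suc (card V)", OF subl] by simp
    then show thesis using that by metis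
  qed
  have xpos: "0 < x v" if "v \<in> V" for v using x that by (auto simp: sub_def)
  have xle: "F x v \<le> l * x v ^ (k - 1)" if "v \<in> V" for v using x that by (auto simp: sub_def)
  have "Z x \<noteq> V"
  proof
    assume ZV: "Z x = V"
    define l' where "l' = Max ((\<lambda>v. F x v / x v ^ (k - 1)) ` V)"
    have "l' \<in> (\<lambda>v. F x v / x v ^ (k - 1)) ` V" unfolding l'_def using finV Vne by (intro Max_in) auto
    then obtain v where v: "v \<in> V" "l' = F x v / x v ^ (k - 1)" by auto
    have "F x v < l * x v ^ (k - 1)" using ZV v by (auto simp: Z_def)
    then have "l' < l" using v xpos by (simp add: field_simps)
    moreover have "sub x l'"
      unfolding sub_def
    proof (intro ballI conjI)
      fix w assume w: "w \<in> V"
      then have "F x w / x w ^ (k - 1) \<le> l'" unfolding l'_def using finV by auto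
      then show "F x w \<le> l' * x w ^ (k - 1)" using xpos[OF w] by (simp add: field_simps)
    qed (use xpos in auto)
    ultimately show False using min by fastforce
  qed
  moreover have "Z x = {} \<or> Z x = V"
  proof (rule ccontr)
    assume c: "\<not> ?thesis"
    have ZV: "Z x \<subseteq> V" by (auto simp: Z_def)
    obtain e where "e \<in> E" "e \<inter> Z x \<noteq> {}" "e \<inter> (V - Z x) \<noteq> {}" using cut[OF ZV] c by blast
    then obtain v u where e: "e \<in> E" and v: "v \<in> e" "v \<in> Z x" and u: "u \<in> e" "u \<in> V" "u \<notin> Z x" by blast
    have vV: "v \<in> V" using v ZV by auto
    have uv: "u \<noteq> v" using u v by auto
    \<comment> \<open>Slack at \<open>v\<close> as a function of the entry at \<open>v\<close>. The
      neighbour sum at \<open>v\<close> does not involve that entry, so by continuity a slightly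
      smaller entry leaves \<open>v\<close> slack.\<close>
    define G where "G \<theta> = l * \<theta> ^ (k - 1) - (\<alpha> * real (degree H v) * \<theta> ^ (k - 1) + (1 - \<alpha>) * nbsum E x v)" for \<theta>
    have "0 < G (x v)" using v by (simp add: G_def Z_def F_def)
    moreover have "isCont G (x v)" unfolding G_def by (intro continuous_intros)
    ultimately have ev: "eventually (\<lambda>\<theta>. 0 < G \<theta>) (at (x v))"
      using order_tendstoD(1)[of G "G (x v)" "at (x v)" 0] by (simp add: isCont_def)
    obtain d where d: "0 < d" "\<And>\<theta>. \<theta> \<noteq> x v \<Longrightarrow> dist \<theta> (x v) < d \<Longrightarrow> 0 < G \<theta>"
      using ev unfolding eventually_at by blast
    define \<theta> where "\<theta> = x v - min (d / 2) (x v / 2)"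
    have \<theta>: "0 < \<theta>" "\<theta> < x v" using xpos[OF vV] d(1) by (auto simp: \<theta>_def min_def)
    have "dist \<theta> (x v) < d" using xpos[OF vV] d(1) by (auto simp: \<theta>_def min_def dist_real_def)
    then have G\<theta>: "0 < G \<theta>" using d(2) \<theta> by simp
    define y where "y = x(v := \<theta>)"
    have ypos: "0 < y w" if "w \<in> V" for w using xpos[OF that] \<theta> by (simp add: y_def)
    have nbv: "nbsum E y v = nbsum E x v"
      unfolding nbsum_def by (intro sum.cong refl prod.cong) (auto simp: y_def)
    have yv: "F y v < l * y v ^ (k - 1)"
      using G\<theta> unfolding F_def nbv by (simp add: G_def y_def)
    have nn: "0 \<le> y w \<and> y w \<le> x w" if "w \<in> V" for w
      using ypos[OF that] \<theta> by (auto simp: y_def)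
    have nbw: "nbsum E y w \<le> nbsum E x w" for w
      using nn by (intro nb_mono) blast
    have Fw: "F y w \<le> F x w" if "w \<noteq> v" for w
      using nbw[of w] that \<alpha> by (simp add: F_def y_def)
    have Fu: "F y u < F x u"
    proof -
      have "nbsum E y u < nbsum E x u"
        unfolding nbsum_def
      proof (rule sum_strict_mono_ex1)
        show "finite {e \<in> E. u \<in> e}" using finE by simp
        show "\<forall>e\<in>{e \<in> E. u \<in> e}. (\<Prod>w\<in>e - {u}. y w) \<le> (\<Prod>w\<in>e - {u}. x w)"
          using EV nn by (intro ballI prod_mono) auto
        have r: "(\<Prod>w\<in>e - {u}. z w) = z v * (\<Prod>w\<in>e - {u} - {v}. z w)" for z :: "'a \<Rightarrow> real"
          using fine[OF e] v(1) uv by (intro prod.remove) auto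
        have "(\<Prod>w\<in>e - {u} - {v}. y w) = (\<Prod>w\<in>e - {u} - {v}. x w)"
          by (intro prod.cong) (auto simp: y_def)
        moreover have "0 < (\<Prod>w\<in>e - {u} - {v}. x w)"
          using EV[OF e] xpos by (intro prod_pos) auto
        ultimately have "(\<Prod>w\<in>e - {u}. y w) < (\<Prod>w\<in>e - {u}. x w)"
          using \<theta> unfolding r by (simp add: y_def)
        then show "\<exists>e\<in>{e \<in> E. u \<in> e}. (\<Prod>w\<in>e - {u}. y w) < (\<Prod>w\<in>e - {u}. x w)"
          using e u by blast
      qed
      then show ?thesis using \<alpha> uv by (simp add: F_def y_def)
    qed
    have "sub y l"
      unfolding sub_def
    proof (intro ballI conjI ypos)
      fix w assume w: "w \<in> V"
      show "F y w \<le> l * y w ^ (k - 1)"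
      proof (cases "w = v")
        case False
        then show ?thesis using Fw[OF False] xle[OF w] by (simp add: y_def)
      qed (use yv in simp)
    qed
    moreover have "insert u (Z x) \<subseteq> Z y"
    proof
      fix w assume w: "w \<in> insert u (Z x)"
      consider "w = v" | "w = u" | "w \<in> Z x" "w \<noteq> v" using w by blast
      then show "w \<in> Z y"
      proof cases
        case 1
        then show ?thesis using yv vV by (simp add: Z_def)
      next
        case 2
        then show ?thesis using Fu xle[OF u(2)] u(2) uv by (simp add: Z_def y_def)
      next
        case 3
        then show ?thesis using Fw[of w] by (simp add: Z_def y_def)
      qed
    qed
    moreover have "finite (Z y)" "finite (Z x)" using finV by (auto simp: Z_def)
    ultimately show False
      using xmax[of y] u(3) card_mono[of "Z y" "insert u (Z x)"] by simp
  qed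
  ultimately have "Z x = {}" by blast
  then have "positive_eigenvector k \<alpha> H l x"
    unfolding positive_eigenvector_def using xpos xle by (force simp: Z_def F_def V_def E_def)
  then show thesis by (rule that)
qed

section \<open>Growing a hypertree edge by edge\<close>

text \<open>A rooted tree recorded by an order of construction: each new edge meets the part already
  built in one vertex, its point of attachment. Read backwards, this is an order in which edges can
  be stripped off from the outside.\<close>

inductive grown :: "'a \<Rightarrow> 'a set \<Rightarrow> 'a set set \<Rightarrow> bool" for r where
  root: "grown r {r} {}"
| edge: "grown r W F \<Longrightarrow> e \<inter> W = {v} \<Longrightarrow> e \<notin> F \<Longrightarrow> grown r (W \<union> e) (insert e F)"

lemma grown_root: "grown r W F \<Longrightarrow> r \<in> W"
  by (induction rule: grown.induct) auto

lemma grown_edge_subset: "grown r W F \<Longrightarrow> e \<in> F \<Longrightarrow> e \<subseteq> W"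
  by (induction rule: grown.induct) auto

lemma grown_covered: "grown r W F \<Longrightarrow> w \<in> W \<Longrightarrow> w \<noteq> r \<Longrightarrow> \<exists>e\<in>F. w \<in> e"
  by (induction rule: grown.induct) auto

lemma grown_finite: "grown r W F \<Longrightarrow> finite F"
  by (induction rule: grown.induct) auto

text \<open>The sets \<open>W\<close> and \<open>F\<close> confine the path, so that an extension by
  a vertex and an edge outside them is automatically free of repetitions.\<close>

definition path_in :: "'a hgraph \<Rightarrow> 'a set \<Rightarrow> 'a set set \<Rightarrow> 'a \<Rightarrow> 'a \<Rightarrow> bool" where
  "path_in H W F u w \<longleftrightarrow> (\<exists>vs es. is_path H vs es \<and> hd vs = u \<and> last vs = w \<and> set vs \<subseteq> W \<and> set es \<subseteq> F)"

lemma path_in_mono: "path_in H W F u w \<Longrightarrow> W \<subseteq> W' \<Longrightarrow> F \<subseteq> F' \<Longrightarrow> path_in H W' F' u w"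
  unfolding path_in_def by blast

lemma path_in_refl: "u \<in> verts H \<Longrightarrow> path_in H {u} {} u u"
  unfolding path_in_def is_path_def by (intro exI[of _ "[u]"] exI[of _ "[]"]) auto

lemma path_in_append:
  assumes p: "path_in H W F u v" and e: "e \<in> edges H" "e \<notin> F" "v \<in> e" "w \<in> e" "w \<notin> W" "w \<in> verts H"
  shows "path_in H (insert w W) (insert e F) u w"
proof -
  obtain vs es where p: "is_path H vs es" "hd vs = u" "last vs = v" "set vs \<subseteq> W" "set es \<subseteq> F"
    using p unfolding path_in_def by blast
  have len: "length vs = Suc (length es)" using p(1) by (simp add: is_path_def)
  then have ne: "vs \<noteq> []" by auto
  have l: "vs ! length es = v" using p(3) len ne by (simp add: last_conv_nth)
  have "is_path H (vs @ [w]) (es @ [e])"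
    using p e len l unfolding is_path_def by (auto simp: nth_append less_Suc_eq)
  then show ?thesis unfolding path_in_def using p ne
    by (intro exI[of _ "vs @ [w]"] exI[of _ "es @ [e]"]) auto
qed

lemma path_in_Cons:
  assumes p: "path_in H W F u v" and e: "e \<in> edges H" "e \<notin> F" "u \<in> e" "w \<in> e" "w \<notin> W" "w \<in> verts H"
  shows "path_in H (insert w W) (insert e F) w v"
proof -
  obtain vs es where p: "is_path H vs es" "hd vs = u" "last vs = v" "set vs \<subseteq> W" "set es \<subseteq> F"
    using p unfolding path_in_def by blast
  have len: "length vs = Suc (length es)" using p(1) by (simp add: is_path_def)
  then have ne: "vs \<noteq> []" by auto
  have h: "vs ! 0 = u" using p(2) ne by (simp add: hd_conv_nth)
  have "is_path H (w # vs) (e # es)"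
    using p e len h unfolding is_path_def by (auto simp: nth_Cons split: nat.splits)
  then show ?thesis unfolding path_in_def using p ne
    by (intro exI[of _ "w # vs"] exI[of _ "e # es"]) auto
qed

lemma path_in_edge:
  assumes "e \<in> edges H" "u \<in> e" "w \<in> e" "u \<in> verts H" "w \<in> verts H"
  shows "path_in H {u, w} {e} u w"
proof (cases "u = w")
  case True
  then show ?thesis using path_in_refl[of u H] assms path_in_mono by fastforce
next
  case False
  have "path_in H (insert w {u}) (insert e {}) u w"
    using path_in_append[OF path_in_refl[OF assms(4)], of e w] assms False by auto
  then show ?thesis by (simp add: insert_commute)
qed

lemma grown_path_in:
  assumes "grown r W F" "hypergraph H" "r \<in> verts H" "F \<subseteq> edges H" "u \<in> W" "w \<in> W"
  shows "path_in H W F u w"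
  using assms
proof (induction arbitrary: u w rule: grown.induct)
  case root
  then show ?case using path_in_refl by fastforce
next
  case (edge W F e v)
  have eH: "e \<in> edges H" using edge.prems by auto
  have eV: "e \<subseteq> verts H" using eH edge.prems(1) by (auto simp: hypergraph_def)
  have v: "v \<in> W" "v \<in> e" using edge.hyps by auto
  have IH: "path_in H W F a b" if "a \<in> W" "b \<in> W" for a b
    using edge.IH edge.prems that by auto
  consider "u \<in> W" "w \<in> W" | "u \<in> W" "w \<notin> W" | "u \<notin> W" "w \<in> W" | "u \<notin> W" "w \<notin> W" by blast
  then show ?case
  proof cases
    case 1
    then show ?thesis using IH path_in_mono by (metis Un_upper1 subset_insertI)
  next
    case 2
    then have "path_in H (insert w W) (insert e F) u w"
      using edge.prems eV v by (intro path_in_append[OF IH[of u v] eH edge.hyps(3)]) auto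
    then show ?thesis by (rule path_in_mono) (use 2 edge.prems in auto)
  next
    case 3
    then have "path_in H (insert u W) (insert e F) u w"
      using edge.prems eV v by (intro path_in_Cons[OF IH[of v w] eH edge.hyps(3)]) auto
    then show ?thesis by (rule path_in_mono) (use 3 edge.prems in auto)
  next
    case 4
    then have "path_in H {u, w} {e} u w"
      using edge.prems eV by (intro path_in_edge eH) auto
    then show ?thesis by (rule path_in_mono) (use 4 edge.prems in auto)
  qed
qed

text \<open>A path inside the built part from \<open>u\<close> to \<open>w\<close>, closed by
  \<open>e\<close>, would be a cycle: \<open>e\<close> differs from the edges of the path because it
  is not in \<open>F\<close>, and the path has an edge because its ends differ.\<close>

lemma hypertree_meets_once:
  assumes tree: "hypertree H" and g: "grown r W F" "r \<in> verts H" "F \<subseteq> edges H" "W \<subseteq> verts H"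
    and e: "e \<in> edges H" "e \<notin> F" "u \<in> e" "u \<in> W" "w \<in> e" "w \<in> W"
  shows "u = w"
proof (rule ccontr)
  assume ne: "u \<noteq> w"
  have H: "hypergraph H" using tree by (simp add: hypertree_def)
  obtain vs es where p: "is_path H vs es" "hd vs = u" "last vs = w" "set vs \<subseteq> W" "set es \<subseteq> F"
    using grown_path_in[OF g(1) H g(2,3) e(4,6)] unfolding path_in_def by blast
  have len: "length vs = Suc (length es)" using p(1) by (simp add: is_path_def)
  obtain vs' where vs: "vs = u # vs'" using p(2) len by (cases vs) auto
  have ese: "es \<noteq> []" using len vs p(3) ne by (cases es) auto
  have l: "vs ! length es = w" using p(3) len vs by (metis last_conv_nth diff_Suc_1 list.distinct(1))
  have "is_cycle H (vs @ [u]) (es @ [e])"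
    unfolding is_cycle_def
  proof (intro conjI allI impI)
    show "length (vs @ [u]) = Suc (length (es @ [e]))" using len by simp
    show "2 \<le> length (es @ [e])" using ese by (cases es) auto
    show "distinct (tl (vs @ [u]))" using p(1) vs by (auto simp: is_path_def)
    show "hd (vs @ [u]) = last (vs @ [u])" using vs by simp
    show "distinct (es @ [e])" using p e by (auto simp: is_path_def)
    show "set (vs @ [u]) \<subseteq> verts H" using p g(4) e by auto
    show "set (es @ [e]) \<subseteq> edges H" using p g(3) e by auto
    fix i assume i: "i < length (es @ [e])"
    show "(vs @ [u]) ! i \<in> (es @ [e]) ! i"
      using i p(1) len l e by (cases "i = length es") (auto simp: is_path_def nth_append)
    show "(vs @ [u]) ! Suc i \<in> (es @ [e]) ! i"
      using i p(1) len l e by (cases "i = length es") (auto simp: is_path_def nth_append)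
  qed
  then show False using tree by (auto simp: hypertree_def)
qed

theorem hypertree_grown:
  assumes tree: "hypertree H" and r: "r \<in> verts H"
  shows "grown r (verts H) (edges H)"
proof -
  have H: "hypergraph H" and cut: "cut_connected H"
    using tree connected_hg_imp_cut_connected[of H] by (auto simp: hypertree_def)
  have finV: "finite (verts H)" and eV: "\<And>e. e \<in> edges H \<Longrightarrow> e \<subseteq> verts H \<and> e \<noteq> {}"
    using H by (auto simp: hypergraph_def)
  have finE: "finite (edges H)" using finV eV by (meson PowI finite_Pow_iff finite_subset subsetI)
  define P where "P p \<longleftrightarrow> grown r (fst p) (snd p) \<and> fst p \<subseteq> verts H \<and> snd p \<subseteq> edges H" for p
  have "P ({r}, {})" using r by (auto simp: P_def intro: grown.root)
  moreover have "\<forall>p. P p \<longrightarrow> card (snd p) < Suc (card (edges H))"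
    using finE by (auto simp: P_def less_Suc_eq_le intro: card_mono)
  ultimately have "\<exists>p. P p \<and> (\<forall>q. P q \<longrightarrow> card (snd q) \<le> card (snd p))"
    by (rule ex_has_greatest_nat)
  then obtain W F where "P (W, F)" and max: "\<And>q. P q \<Longrightarrow> card (snd q) \<le> card F" by auto
  then have g: "grown r W F" and W: "W \<subseteq> verts H" and F: "F \<subseteq> edges H" by (auto simp: P_def)
  have no: False if e: "e \<in> edges H" "e \<notin> F" "v \<in> e" "v \<in> W" for e v
  proof -
    have "e \<inter> W = {v}" using hypertree_meets_once[OF tree g r F W e(1,2)] e by blast
    then have "grown r (W \<union> e) (insert e F)" using g e by (intro grown.edge)
    then have "P (W \<union> e, insert e F)" using e W F eV by (auto simp: P_def)
    then show False using max[of "(W \<union> e, insert e F)"] e grown_finite[OF g] by simp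
  qed
  have WV: "W = verts H"
  proof (rule ccontr)
    assume "W \<noteq> verts H"
    moreover have "W \<noteq> {}" using grown_root[OF g] by auto
    ultimately obtain e where e: "e \<in> edges H" "e \<inter> W \<noteq> {}" "e \<inter> (verts H - W) \<noteq> {}"
      using cut W unfolding cut_connected_def by meson
    moreover have "e \<notin> F" using e(3) grown_edge_subset[OF g] by blast
    ultimately show False using no by blast
  qed
  moreover have "F = edges H"
  proof (rule ccontr)
    assume "F \<noteq> edges H"
    then obtain e where "e \<in> edges H" "e \<notin> F" using F by blast
    then show False using no eV[of e] WV by blast
  qed
  ultimately show ?thesis using g by simp
qed

section \<open>Spiders\<close>

text \<open>The coordinates of \<open>Tedge\<close> with arbitrary leg lengths. Legs are numbered
  from 1 as in \<open>T_mtk\<close>, hence the index \<open>j - 1\<close>; the first coordinate 0 is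
  reserved for the centre.\<close>

definition spider_verts :: "nat \<Rightarrow> nat list \<Rightarrow> (nat \<times> nat \<times> nat) set" where
  "spider_verts k L = insert (0, 0, 0)
     {(j, i, r). 1 \<le> j \<and> j \<le> length L \<and> 1 \<le> i \<and> i \<le> L ! (j - 1) \<and> r \<le> k - 2}"

definition spider_edges :: "nat \<Rightarrow> nat list \<Rightarrow> (nat \<times> nat \<times> nat) set set" where
  "spider_edges k L = {Tedge k j i | j i. 1 \<le> j \<and> j \<le> length L \<and> 1 \<le> i \<and> i \<le> L ! (j - 1)}"

text \<open>A multiset of lengths, because legs may be listed in any order; a marked centre, because
  further legs are attached there; and a separate vertex set, because a spider without legs has no
  edges to determine it.\<close>

definition is_spider :: "nat \<Rightarrow> 'a \<Rightarrow> 'a set \<Rightarrow> 'a set set \<Rightarrow> nat multiset \<Rightarrow> bool" where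
  "is_spider k w Y F M \<longleftrightarrow> (\<exists>L f. mset L = M \<and> bij_betw f (spider_verts k L) Y \<and> f (0, 0, 0) = w \<and>
     (\<lambda>e. f ` e) ` spider_edges k L = F)"

lemma spider_Nil [simp]: "spider_verts k [] = {(0, 0, 0)}" "spider_edges k [] = {}"
  by (auto simp: spider_verts_def spider_edges_def)

lemma spider_edgesI:
  "1 \<le> j \<Longrightarrow> j \<le> length L \<Longrightarrow> 1 \<le> i \<Longrightarrow> i \<le> L ! (j - 1) \<Longrightarrow> Tedge k j i \<in> spider_edges k L"
  by (auto simp: spider_edges_def)

lemma is_spider_empty: "is_spider k w {w} {} {#}"
  unfolding is_spider_def
  by (intro exI[of _ "[]"] exI[of _ "\<lambda>_. w"]) auto

lemma is_spider_emptyD: "is_spider k w Y F {#} \<Longrightarrow> Y = {w} \<and> F = {}"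
  unfolding is_spider_def by (auto simp: bij_betw_def)

lemma Tedge_Suc: "Tedge k j (Suc (Suc i)) = insert (j, Suc i, 0) {(j, Suc (Suc i), r) | r. r \<le> k - 2}"
  and Tedge_1: "Tedge k j (Suc 0) = insert (0, 0, 0) {(j, Suc 0, r) | r. r \<le> k - 2}"
  by (auto simp: Tedge_def)

text \<open>A spider at \<open>u\<close> with at most one leg is a path ending in \<open>u\<close>.
  The edge through \<open>v\<close>, \<open>u\<close> and the points of \<open>X\<close> lengthens
  this path by one and turns it into a leg at \<open>v\<close>. The sum of \<open>N\<close> is the
  old length, 0 if \<open>u\<close> is bare.\<close>

lemma is_spider_add_leg:
  assumes k: "2 \<le> k" and v: "is_spider k v Yv Fv M" and u: "is_spider k u Yu Fu N" "size N \<le> 1"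
    and X: "finite X" "card X = k - 2"
    and disj: "Yv \<inter> Yu = {}" "X \<inter> Yv = {}" "X \<inter> Yu = {}"
  shows "is_spider k v (Yv \<union> (Yu \<union> X)) (Fv \<union> (insert (insert v (insert u X)) Fu)) (add_mset (Suc (\<Sum>\<^sub># N)) M)"
proof -
  obtain Lv fv where Lv: "mset Lv = M" and fv: "bij_betw fv (spider_verts k Lv) Yv" "fv (0, 0, 0) = v"
    "(\<lambda>e. fv ` e) ` spider_edges k Lv = Fv" using v unfolding is_spider_def by blast
  obtain Lu fu where Lu: "mset Lu = N" and fu: "bij_betw fu (spider_verts k Lu) Yu" "fu (0, 0, 0) = u"
    "(\<lambda>e. fu ` e) ` spider_edges k Lu = Fu" using u(1) unfolding is_spider_def by blast
  define h where "h = \<Sum>\<^sub># N"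
  have Lu': "Lu = [] \<and> h = 0 \<or> Lu = [h]"
  proof (cases Lu)
    case Nil
    then show ?thesis using Lu by (auto simp: h_def)
  next
    case (Cons a l)
    then have "l = []" using u(2) Lu by auto
    then show ?thesis using Cons Lu by (auto simp: h_def)
  qed
  obtain b where b: "bij_betw b {1..k - 2} X" using ex_bij_betw_nat_finite_1[OF X(1)] X(2) by auto
  define n where "n = length Lv"
  define L where "L = Lv @ [Suc h]"
  \<comment> \<open>The new leg receives the number \<open>Suc n\<close>. The old leg of
    \<open>u\<close> is shifted outwards by one edge, \<open>u\<close> takes the place (Suc n, 1,
    0), and \<open>X\<close> takes the places of the first edge with r >= 1.\<close>
  define f where "f p = (case p of (j, i, r) \<Rightarrow> if j = Suc n then
      (if i = Suc 0 then (if r = 0 then u else b r) else fu (Suc 0, i - 1, r)) else fv (j, i, r))" for p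
  define g where "g p = (case p of (j, i, r) \<Rightarrow> (Suc n, Suc i, r))" for p :: "nat \<times> nat \<times> nat"
  define A where "A = {(Suc n, Suc 0, r) | r. 1 \<le> r \<and> r \<le> k - 2}"
  have su: "spider_verts k Lu = insert (0, 0, 0) {(Suc 0, i, r) | i r. 1 \<le> i \<and> i \<le> h \<and> r \<le> k - 2}"
    using Lu' by (auto simp: spider_verts_def le_Suc_eq)
  have eu: "spider_edges k Lu = {Tedge k (Suc 0) i | i. 1 \<le> i \<and> i \<le> h}"
  proof -
    have "spider_edges k [h] = {Tedge k (Suc 0) i | i. 1 \<le> i \<and> i \<le> h}"
      using spider_edgesI[of "Suc 0" "[h]" _ k] by (auto simp: spider_edges_def le_Suc_eq)
    then show ?thesis using Lu' by auto
  qed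
  have sv: "(\<exists>i r. p = (j, i, r) \<and> j \<noteq> Suc n)" if "p \<in> spider_verts k Lv" "j = fst p" for p j
    using that by (auto simp: spider_verts_def n_def)
  have fg: "f (g p) = fu p" if "p \<in> spider_verts k Lu" for p
    using that fu(2) unfolding su by (auto simp: f_def g_def)
  have V: "spider_verts k L = spider_verts k Lv \<union> (g ` spider_verts k Lu \<union> A)"
  proof (intro equalityI subsetI)
    fix p assume p: "p \<in> spider_verts k L"
    obtain j i r where pj: "p = (j, i, r)" by (cases p)
    consider "p = (0, 0, 0)" | "1 \<le> j" "j \<le> n" "1 \<le> i" "i \<le> Lv ! (j - 1)" "r \<le> k - 2"
      | "j = Suc n" "1 \<le> i" "i \<le> Suc h" "r \<le> k - 2"
      using p pj by (auto simp: spider_verts_def L_def n_def nth_append le_Suc_eq split: if_splits)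
    then show "p \<in> spider_verts k Lv \<union> (g ` spider_verts k Lu \<union> A)"
    proof cases
      case 3
      have "i = 1 \<and> r = 0 \<or> i = 1 \<and> 1 \<le> r \<or> (\<exists>i'. i = Suc i' \<and> 1 \<le> i')"
        using 3(2) by (cases i) (auto simp: Suc_le_eq)
      then consider "i = 1" "r = 0" | "i = 1" "1 \<le> r" | i' where "i = Suc i'" "1 \<le> i'" by blast
      then show ?thesis
      proof cases
        case 1
        then have "p = g (0, 0, 0)" using pj 3 by (simp add: g_def)
        then show ?thesis unfolding su by blast
      next
        case 2
        then show ?thesis using pj 3 by (auto simp: A_def)
      next
        case (3 i')
        then have "p = g (Suc 0, i', r)" "(Suc 0, i', r) \<in> spider_verts k Lu"
          using pj \<open>j = Suc n\<close> \<open>i \<le> Suc h\<close> \<open>r \<le> k - 2\<close> by (auto simp: g_def su)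
        then show ?thesis by blast
      qed
    qed (use pj in \<open>auto simp: spider_verts_def n_def\<close>)
  next
    fix p assume "p \<in> spider_verts k Lv \<union> (g ` spider_verts k Lu \<union> A)"
    then show "p \<in> spider_verts k L"
      unfolding su A_def by (auto simp: spider_verts_def L_def n_def g_def nth_append)
  qed
  have bv: "bij_betw f (spider_verts k Lv) Yv"
    using fv(1) by (rule bij_betw_cong[THEN iffD1, rotated]) (use sv in \<open>force simp: f_def\<close>)
  have inju: "inj_on f (g ` spider_verts k Lu)"
    by (rule inj_on_imageI) (use fu(1) fg in \<open>auto simp: bij_betw_def inj_on_def\<close>)
  have bu: "bij_betw f (g ` spider_verts k Lu) Yu"
    unfolding bij_betw_def using inju fu(1) fg by (auto simp: bij_betw_def image_image)
  have bA: "bij_betw f A X"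
  proof -
    have fA: "f (Suc n, Suc 0, r) = b r" if "1 \<le> r" for r using that by (simp add: f_def)
    have "A = (\<lambda>r. (Suc n, Suc 0, r)) ` {1..k - 2}" by (auto simp: A_def)
    then show ?thesis using b fA by (auto simp: bij_betw_def inj_on_def image_image)
  qed
  have bf: "bij_betw f (spider_verts k L) (Yv \<union> (Yu \<union> X))"
    unfolding V using bv bu bA disj by (intro bij_betw_combine) auto
  have f0: "f (0, 0, 0) = v" using fv(2) by (simp add: f_def)
  have E: "spider_edges k L = spider_edges k Lv \<union> insert (Tedge k (Suc n) (Suc 0))
      {Tedge k (Suc n) (Suc i) | i. 1 \<le> i \<and> i \<le> h}" (is "_ = ?R")
  proof (intro equalityI subsetI)
    fix e assume "e \<in> spider_edges k L"
    then obtain j i where ji: "e = Tedge k j i" "1 \<le> j" "j \<le> Suc n" "1 \<le> i" "i \<le> L ! (j - 1)"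
      by (auto simp: spider_edges_def L_def n_def)
    show "e \<in> ?R"
    proof (cases "j = Suc n")
      case True
      then have "i \<le> Suc h" using ji by (simp add: L_def n_def nth_append)
      then have "i = Suc 0 \<or> (\<exists>i'. i = Suc i' \<and> 1 \<le> i' \<and> i' \<le> h)"
        using ji(4) by (cases i) (auto simp: Suc_le_eq)
      then show ?thesis using True ji(1) by blast
    next
      case False
      then have "j \<le> length Lv" using ji(3) by (simp add: n_def)
      moreover have "L ! (j - 1) = Lv ! (j - 1)" 
      proof -
        have "j - 1 < length Lv" using \<open>j \<le> length Lv\<close> ji(2) by linarith
        then show ?thesis by (simp add: L_def nth_append)
      qed
      ultimately show ?thesis using spider_edgesI[of j Lv i k] ji by simp
    qed
  next
    fix e assume "e \<in> ?R"
    then consider "e \<in> spider_edges k Lv" | i where "e = Tedge k (Suc n) (Suc i)" "i \<le> h" by auto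
    then show "e \<in> spider_edges k L"
    proof cases
      case 1
      then obtain j i where "e = Tedge k j i" "1 \<le> j" "j \<le> n" "1 \<le> i" "i \<le> Lv ! (j - 1)"
        by (auto simp: spider_edges_def n_def)
      moreover have "j - 1 < length Lv" using calculation by (simp add: n_def)
      ultimately show ?thesis using spider_edgesI[of j L i k] by (simp add: L_def n_def nth_append)
    next
      case (2 i)
      then show ?thesis using spider_edgesI[of "Suc n" L "Suc i" k] by (auto simp: L_def n_def nth_append)
    qed
  qed
  have ev: "f ` e = fv ` e" if "e \<in> spider_edges k Lv" for e
  proof (rule image_cong[OF refl])
    fix p assume "p \<in> e"
    then show "f p = fv p" using that by (auto simp: spider_edges_def Tedge_def f_def n_def split: if_splits)
  qed
  have e1: "f ` Tedge k (Suc n) (Suc 0) = insert v (insert u X)"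
  proof -
    have "Tedge k (Suc n) (Suc 0) = insert (0, 0, 0) (insert (Suc n, Suc 0, 0) A)"
      by (auto simp: Tedge_1 A_def Suc_le_eq)
    moreover have "f (Suc n, Suc 0, 0) = u" by (simp add: f_def)
    moreover have "f ` A = X" using bA by (simp add: bij_betw_def)
    ultimately show ?thesis using f0 by simp
  qed
  have ei: "f ` Tedge k (Suc n) (Suc i) = fu ` Tedge k (Suc 0) i" if i: "1 \<le> i" "i \<le> h" for i
  proof -
    have sub: "Tedge k (Suc 0) i \<subseteq> spider_verts k Lu"
      unfolding su using i by (auto simp: Tedge_def)
    have "Tedge k (Suc n) (Suc i) = g ` Tedge k (Suc 0) i"
    proof -
      obtain i' where i': "i = Suc i'" using i by (cases i) auto
      have "g ` {(Suc 0, i, r) | r. r \<le> k - 2} = {(Suc n, Suc i, r) | r. r \<le> k - 2}"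
        by (auto simp: g_def image_iff)
      then show ?thesis unfolding i' by (cases i') (simp_all add: Tedge_Suc Tedge_1 g_def)
    qed
    then show ?thesis using fg sub by (auto simp: image_image intro!: image_cong)
  qed
  have "(\<lambda>e. f ` e) ` {Tedge k (Suc n) (Suc i) | i. 1 \<le> i \<and> i \<le> h} = Fu"
    unfolding fu(3)[symmetric] eu using ei by (auto simp: image_iff) blast+
  moreover have "(\<lambda>e. f ` e) ` spider_edges k Lv = Fv" unfolding fv(3)[symmetric] using ev by (rule image_cong[OF refl])
  ultimately have "(\<lambda>e. f ` e) ` spider_edges k L = Fv \<union> (insert (insert v (insert u X)) Fu)"
    unfolding E image_Un image_insert e1 by simp
  moreover have "mset L = add_mset (Suc (\<Sum>\<^sub># N)) M" using Lv by (simp add: L_def h_def)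
  ultimately show ?thesis unfolding is_spider_def using bf f0 by blast
qed

section \<open>Isomorphisms of spiders\<close>

lemma hg_iso_sym:
  assumes "hg_iso G H" "hypergraph G" shows "hg_iso H G"
proof -
  obtain f where f: "bij_betw f (verts G) (verts H)" "(\<lambda>e. f ` e) ` edges G = edges H"
    using assms(1) by (auto simp: hg_iso_def)
  let ?g = "inv_into (verts G) f"
  have "?g ` f ` e = e" if "e \<in> edges G" for e
    using that assms(2) f(1) by (intro inv_into_image_cancel) (auto simp: hypergraph_def bij_betw_def)
  then have "(\<lambda>e. ?g ` e) ` edges H = edges G" unfolding f(2)[symmetric] by (auto simp: image_image)
  then show ?thesis using bij_betw_inv_into[OF f(1)] by (auto simp: hg_iso_def)
qed

lemma hg_iso_trans:
  assumes "hg_iso G H" "hg_iso H K" shows "hg_iso G K"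
proof -
  obtain f g where f: "bij_betw f (verts G) (verts H)" "(\<lambda>e. f ` e) ` edges G = edges H"
    and g: "bij_betw g (verts H) (verts K)" "(\<lambda>e. g ` e) ` edges H = edges K"
    using assms by (auto simp: hg_iso_def)
  have "(\<lambda>e. (g \<circ> f) ` e) ` edges G = edges K" unfolding g(2)[symmetric] f(2)[symmetric]
    by (simp add: image_image image_comp)
  then show ?thesis using bij_betw_trans[OF f(1) g(1)] unfolding hg_iso_def by blast
qed

lemma hypergraph_spider: "hypergraph (spider_verts k L, spider_edges k L)"
proof -
  have "spider_verts k L \<subseteq> insert (0, 0, 0) ({..length L} \<times> {..Max (set L)} \<times> {..k - 2})"
    by (auto simp: spider_verts_def intro!: order_trans[OF _ Max_ge])
  then have "finite (spider_verts k L)" by (rule finite_subset) auto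
  moreover have "e \<subseteq> spider_verts k L \<and> e \<noteq> {}" if "e \<in> spider_edges k L" for e
  proof -
    obtain j i where "e = Tedge k j i" "1 \<le> j" "j \<le> length L" "1 \<le> i" "i \<le> L ! (j - 1)"
      using \<open>e \<in> spider_edges k L\<close> unfolding spider_edges_def by blast
    then show ?thesis by (cases "i = 1") (auto simp: spider_verts_def Tedge_def)
  qed
  ultimately show ?thesis by (simp add: hypergraph_def verts_def edges_def)
qed

lemma spider_iso_perm:
  assumes "mset L = mset L'"
  shows "hg_iso (spider_verts k L, spider_edges k L) (spider_verts k L', spider_edges k L')"
proof -
  obtain \<pi> where p: "bij_betw \<pi> {..<length L} {..<length L'}" "\<And>i. i < length L \<Longrightarrow> L ! i = L' ! \<pi> i"
    using permutation_Ex_bij[OF assms] by blast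
  \<comment> \<open>Positions in the list start at 0 but leg numbers at 1, hence the shift; the
    number 0 stays with the centre.\<close>
  define f where "f q = (case q of (j, i, r) \<Rightarrow> (if j = 0 then 0 else Suc (\<pi> (j - 1)), i, r))"
    for q :: "nat \<times> nat \<times> nat"
  have f0: "f (0, i, r) = (0, i, r)" and fS: "f (Suc j, i, r) = (Suc (\<pi> j), i, r)" for i r j
    by (auto simp: f_def)
  have \<pi>: "\<pi> j < length L'" if "j < length L" for j using p(1) that by (auto simp: bij_betw_def)
  have \<pi>inj: "\<pi> j = \<pi> j' \<longleftrightarrow> j = j'" if "j < length L" "j' < length L" for j j'
    using p(1) that by (auto simp: bij_betw_def inj_on_def)
  have \<pi>surj: "\<exists>j<length L. \<pi> j = j'" if "j' < length L'" for j'
  proof -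
    have "j' \<in> \<pi> ` {..<length L}" using bij_betw_imp_surj_on[OF p(1)] that by simp
    then show ?thesis by blast
  qed
  have sv: "q \<in> spider_verts k L \<longleftrightarrow> q = (0, 0, 0) \<or>
      (\<exists>j i r. q = (Suc j, i, r) \<and> j < length L \<and> 1 \<le> i \<and> i \<le> L ! j \<and> r \<le> k - 2)" for q and L :: "nat list"
  proof -
    obtain a i r where q: "q = (a, i, r)" by (cases q)
    show ?thesis unfolding q by (cases a) (auto simp: spider_verts_def Suc_le_eq)
  qed
  have se: "spider_edges k L = {Tedge k (Suc j) i | j i. j < length L \<and> 1 \<le> i \<and> i \<le> L ! j}" for L :: "nat list"
    unfolding spider_edges_def by (force simp: gr0_conv_Suc Suc_le_eq intro: exI[of _ "Suc _"])
  have "inj_on f (spider_verts k L)"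
    by (rule inj_onI) (auto simp: f0 fS \<pi>inj sv)
  moreover have "f ` spider_verts k L = spider_verts k L'"
  proof (intro equalityI subsetI)
    fix q assume "q \<in> f ` spider_verts k L"
    then obtain q' where q': "q' \<in> spider_verts k L" "q = f q'" by blast
    consider "q' = (0, 0, 0)" | j i r where "q' = (Suc j, i, r)" "j < length L" "1 \<le> i" "i \<le> L ! j" "r \<le> k - 2"
      using q'(1) unfolding sv by blast
    then show "q \<in> spider_verts k L'"
    proof cases
      case 1
      then show ?thesis using q' by (simp add: f0 sv)
    next
      case (2 j i r)
      then show ?thesis using q' p(2) \<pi> by (simp add: fS sv)
    qed
  next
    fix q assume "q \<in> spider_verts k L'"
    then consider "q = (0, 0, 0)" | j i r where "q = (Suc j, i, r)" "j < length L'" "1 \<le> i" "i \<le> L' ! j" "r \<le> k - 2"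
      unfolding sv by blast
    then show "q \<in> f ` spider_verts k L"
    proof cases
      case 1
      then show ?thesis by (intro image_eqI[of _ _ "(0, 0, 0)"]) (auto simp: f0 sv)
    next
      case (2 j i r)
      then obtain j' where "j' < length L" "\<pi> j' = j" using \<pi>surj by blast
      then show ?thesis using 2 p(2) by (intro image_eqI[of _ _ "(Suc j', i, r)"]) (auto simp: fS sv)
    qed
  qed
  moreover have fT: "f ` Tedge k (Suc j) i = Tedge k (Suc (\<pi> j)) i" for j i
    by (auto simp: Tedge_def fS f0 image_iff)
  have "(\<lambda>e. f ` e) ` spider_edges k L = spider_edges k L'"
  proof (intro equalityI subsetI)
    fix e assume "e \<in> (\<lambda>e. f ` e) ` spider_edges k L"
    then show "e \<in> spider_edges k L'" unfolding se using fT p(2) \<pi> by fastforce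
  next
    fix e assume "e \<in> spider_edges k L'"
    then obtain j i where e: "e = Tedge k (Suc j) i" "j < length L'" "1 \<le> i" "i \<le> L' ! j" unfolding se by blast
    then obtain j' where "j' < length L" "\<pi> j' = j" using \<pi>surj by blast
    then show "e \<in> (\<lambda>e. f ` e) ` spider_edges k L"
      using e p(2) spider_edgesI[of "Suc j'" L i k] by (intro image_eqI[of _ _ "Tedge k (Suc j') i"]) (auto simp: fT)
  qed
  ultimately show ?thesis unfolding hg_iso_def bij_betw_def by (auto simp: verts_def edges_def)
qed

definition Tlens :: "nat \<Rightarrow> nat \<Rightarrow> nat list" where
  "Tlens m t = map (Tlen m t) [1..<Suc t]"

lemma T_mtk_spider: "T_mtk m t k = (spider_verts k (Tlens m t), spider_edges k (Tlens m t))"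
proof -
  have nth: "Tlens m t ! (j - 1) = Tlen m t j" if "1 \<le> j" "j \<le> t" for j
    using that by (auto simp: Tlens_def nth_map_upt simp del: upt_Suc)
  have len: "length (Tlens m t) = t" by (simp add: Tlens_def)
  have E: "Tedges m t k = spider_edges k (Tlens m t)"
    unfolding Tedges_def spider_edges_def len by (intro Collect_cong) (metis nth)
  have "insert (0, 0, 0) (\<Union> (spider_edges k (Tlens m t))) = spider_verts k (Tlens m t)"
  proof (intro equalityI subsetI)
    fix p assume "p \<in> insert (0, 0, 0) (\<Union> (spider_edges k (Tlens m t)))"
    then show "p \<in> spider_verts k (Tlens m t)"
      using hypergraph_spider[of k "Tlens m t"] by (auto simp: hypergraph_def verts_def edges_def spider_verts_def)
  next
    fix p assume "p \<in> spider_verts k (Tlens m t)"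
    then show "p \<in> insert (0, 0, 0) (\<Union> (spider_edges k (Tlens m t)))"
    proof (cases "p = (0, 0, 0)")
      case False
      then obtain j i r where p: "p = (j, i, r)" "1 \<le> j" "j \<le> length (Tlens m t)" "1 \<le> i"
          "i \<le> Tlens m t ! (j - 1)" "r \<le> k - 2"
        using \<open>p \<in> spider_verts k (Tlens m t)\<close> by (auto simp: spider_verts_def)
      then have "p \<in> Tedge k j i" by (simp add: Tedge_def)
      then show ?thesis using spider_edgesI[OF p(2-5)] by blast
    qed simp
  qed
  then show ?thesis by (simp add: T_mtk_def E)
qed

lemma is_spider_iso_T:
  assumes "is_spider k r (verts G) (edges G) (mset (Tlens m t))"
  shows "hg_iso G (T_mtk m t k)"
proof -
  obtain L f where L: "mset L = mset (Tlens m t)" and f: "bij_betw f (spider_verts k L) (verts G)"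
    "(\<lambda>e. f ` e) ` spider_edges k L = edges G" using assms unfolding is_spider_def by blast
  have "hg_iso (spider_verts k L, spider_edges k L) G"
    unfolding hg_iso_def using f by (auto simp: verts_def edges_def)
  then have "hg_iso G (spider_verts k L, spider_edges k L)" by (rule hg_iso_sym[OF _ hypergraph_spider])
  then show ?thesis unfolding T_mtk_spider by (rule hg_iso_trans[OF _ spider_iso_perm[OF L]])
qed

section \<open>Weights of legs\<close>

text \<open>The value 0 for the empty leg lets one recursion cover the last edge as well: its outer
  end has degree 1 and g = L = L - 0. So \<open>leg\<close> at 1 is \<alpha> + c / L.\<close>

primrec leg :: "real \<Rightarrow> real \<Rightarrow> real \<Rightarrow> nat \<Rightarrow> real" where
  "leg \<alpha> L c 0 = 0"
| "leg \<alpha> L c (Suc n) = \<alpha> + c / (L - leg \<alpha> L c n)"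

locale leg_weights =
  fixes \<alpha> L c :: real
  assumes alpha_nonneg: "0 \<le> \<alpha>" and L_pos: "0 < L" and c_pos: "0 < c"
begin

abbreviation s :: "nat \<Rightarrow> real" where "s \<equiv> leg \<alpha> L c"
abbreviation legsum :: "nat multiset \<Rightarrow> real" where "legsum M \<equiv> \<Sum>\<^sub># (image_mset s M)"

text \<open>All denominators entering \<open>s n\<close> are positive. The bound stops before
  \<open>s n\<close> itself, since at the centre the legs only have to fit into a total of L +
  \<alpha>.\<close>

definition valid :: "nat \<Rightarrow> bool" where "valid n \<longleftrightarrow> (\<forall>i<n. s i < L)"

lemma valid_0 [simp]: "valid 0" by (simp add: valid_def)

lemma valid_Suc: "valid (Suc n) \<longleftrightarrow> valid n \<and> s n < L"
  by (auto simp: valid_def less_Suc_eq)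

lemma leg_gt_alpha: "valid n \<Longrightarrow> 0 < n \<Longrightarrow> \<alpha> < s n"
  using c_pos by (cases n) (auto simp: valid_Suc)

lemma leg_nonneg: "valid n \<Longrightarrow> 0 \<le> s n"
  using leg_gt_alpha[of n] alpha_nonneg by (cases "n = 0") auto

lemma leg_less_Suc: "valid (Suc n) \<Longrightarrow> s n < s (Suc n)"
proof (induction n)
  case 0
  then show ?case using leg_gt_alpha[of "Suc 0"] alpha_nonneg by simp
next
  case (Suc n)
  then have "s n < s (Suc n)" "s (Suc n) < L" by (auto simp: valid_Suc)
  then have "c / (L - s n) < c / (L - s (Suc n))" using c_pos by (intro divide_strict_left_mono) auto
  then show ?case by simp
qed

lemma leg_strict_mono: "valid j \<Longrightarrow> i < j \<Longrightarrow> s i < s j"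
proof (induction j)
  case (Suc j)
  then show ?case using leg_less_Suc[OF Suc.prems(1)] by (cases "i = j") (auto simp: valid_Suc)
qed simp

lemma legsum_nonneg: "(\<And>h. h \<in># M \<Longrightarrow> valid h) \<Longrightarrow> 0 \<le> legsum M"
  by (induction M) (auto intro!: add_nonneg_nonneg leg_nonneg)

lemma legsum_pos: "M \<noteq> {#} \<Longrightarrow> (\<And>h. h \<in># M \<Longrightarrow> valid h \<and> 1 \<le> h) \<Longrightarrow> 0 < legsum M"
proof (cases M)
  case (add h M')
  assume *: "\<And>h. h \<in># M \<Longrightarrow> valid h \<and> 1 \<le> h"
  then have "0 < s h" "0 \<le> legsum M'"
    using leg_gt_alpha[of h] alpha_nonneg legsum_nonneg[of M'] add by force+
  then show ?thesis using add by simp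
qed simp

text \<open>This measures the effect of moving one edge from a leg of length j + 1 to one of length
  i. For i < j the first factor is positive, so the sign depends only on whether c exceeds the
  product of L - s i and L - s j.\<close>

lemma shift_identity:
  assumes "s i < L" "s j < L"
  shows "s (Suc i) + s j - (s i + s (Suc j)) =
    ((L - s i) - (L - s j)) * (1 - c / ((L - s i) * (L - s j)))"
proof -
  have "(a - b) * (1 - c / (a * b)) = a - b + c / a - c / b" if "0 < a" "0 < b" for a b :: real
    using that by (simp add: field_simps)
  from this[of "L - s i" "L - s j"] show ?thesis using assms by simp
qed

text \<open>Since s (i + 1) = \<alpha> + c / (L - s i), the bound on the more balanced pair says
  precisely that c is at most the product of L - s i and L - s j.\<close>

lemma shift_le:
  assumes "i < j" "valid (Suc j)" "s (Suc i) + s j \<le> L + \<alpha>"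
  shows "s i + s (Suc j) \<le> s (Suc i) + s j"
proof -
  have lt: "s i < s j" and L: "s i < L" "s j < L"
    using leg_strict_mono[of j i] assms by (auto simp: valid_def)
  have "c / (L - s i) \<le> L - s j" using assms(3) by simp
  then have "c \<le> (L - s i) * (L - s j)" using L by (simp add: divide_le_eq mult.commute)
  then have "c / ((L - s i) * (L - s j)) \<le> 1" using L by (simp only: divide_le_eq_1_pos mult_pos_pos diff_gt_0_iff_gt)
  then show ?thesis using shift_identity[OF L] lt by (smt (verit) mult_nonneg_nonneg)
qed

lemma shift_less:
  assumes "i < j" "valid (Suc j)" "c \<le> (L - s j) * (L - s j)"
  shows "s i + s (Suc j) < s (Suc i) + s j"
proof -
  have lt: "s i < s j" and L: "s i < L" "s j < L"
    using leg_strict_mono[of j i] assms by (auto simp: valid_def)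
  have "(L - s j) * (L - s j) < (L - s i) * (L - s j)" using lt L by (intro mult_strict_right_mono) auto
  then have "c < (L - s i) * (L - s j)" using assms(3) by linarith
  then have "c / ((L - s i) * (L - s j)) < 1" using L by (simp only: divide_less_eq_1_pos mult_pos_pos diff_gt_0_iff_gt)
  then show ?thesis using shift_identity[OF L] lt by (smt (verit) mult_pos_pos)
qed

end

section \<open>Balancing the legs\<close>

definition balanced :: "nat multiset \<Rightarrow> bool" where
  "balanced M \<longleftrightarrow> (\<forall>x\<in>#M. \<forall>y\<in>#M. x \<le> y + 1)"

text \<open>Only the minimum p and p + 1 occur, and p does occur, so writing the sum as p times the
  size plus the number of entries p + 1 is division with remainder. Size and sum therefore determine
  a balanced multiset.\<close>

lemma balanced_eq:
  assumes "balanced M" "M \<noteq> {#}"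
  shows "M = replicate_mset (size M - \<Sum>\<^sub># M mod size M) (\<Sum>\<^sub># M div size M) +
             replicate_mset (\<Sum>\<^sub># M mod size M) (\<Sum>\<^sub># M div size M + 1)"
proof -
  define p where "p = Min (set_mset M)"
  have p: "p \<in># M" "\<And>x. x \<in># M \<Longrightarrow> p \<le> x" using assms(2) by (auto simp: p_def)
  have mem: "x = p \<or> x = p + 1" if "x \<in># M" for x
    using assms(1) p that unfolding balanced_def by (metis add.commute le_Suc_eq nat_less_le not_less_eq plus_1_eq_Suc)
  define d e where "d = count M p" and "e = count M (p + 1)"
  have M: "M = replicate_mset d p + replicate_mset e (p + 1)"
  proof (rule multiset_eqI)
    fix x show "count M x = count (replicate_mset d p + replicate_mset e (p + 1)) x"
      using mem[of x] by (cases "x \<in># M") (auto simp: d_def e_def count_eq_zero_iff)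
  qed
  have d: "0 < d" using p(1) by (simp add: d_def)
  have sz: "size M = d + e" and sm: "\<Sum>\<^sub># M = p * (d + e) + e" by (subst M, simp add: algebra_simps)+
  have "\<Sum>\<^sub># M div size M = p" "\<Sum>\<^sub># M mod size M = e" unfolding sz sm using d by auto
  then show ?thesis using M sz by simp
qed

lemma not_balanced_split:
  assumes "\<not> balanced M"
  obtains i j R where "M = {#i, Suc j#} + R" "i < j"
proof -
  obtain a i where a: "a \<in># M" "i \<in># M" "i + 1 < a" using assms by (auto simp: balanced_def not_le)
  then obtain R where "M = {#i, a#} + R"
    by (metis add_mset_add_single insert_DiffM insert_noteq_member less_irrefl_nat add_lessD1 union_commute union_mset_add_mset_left)
  moreover obtain j where "a = Suc j" using a by (cases a) auto
  ultimately show thesis using a that by auto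
qed

context leg_weights
begin

text \<open>Each balancing move lowers the sum of squares, so the more balanced multiset is treated
  earlier. Its legs are then known to be valid and to fit under L + \<alpha>, and from this the
  validity of the longer leg before the move is deduced rather than assumed.\<close>

lemma legsum_le_balanced:
  assumes N: "balanced N" "2 \<le> size N" "\<And>x. x \<in># N \<Longrightarrow> valid x" "legsum N \<le> L + \<alpha>"
    and M: "size M = size N" "\<Sum>\<^sub># M = \<Sum>\<^sub># N" "\<And>x. x \<in># M \<Longrightarrow> 1 \<le> x"
  shows "(\<forall>x\<in>#M. valid x) \<and> legsum M \<le> legsum N"
  using M
proof (induction "\<Sum>\<^sub># (image_mset (\<lambda>x. x * x) M)" arbitrary: M rule: less_induct)
  case less
  show ?case
  proof (cases "balanced M")
    case True
    have ne: "M \<noteq> {#}" "N \<noteq> {#}" using N(2) less.prems(1) by auto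
    have "M = N"
      using balanced_eq[OF True ne(1)] balanced_eq[OF N(1) ne(2)] less.prems by metis
    then show ?thesis using N(3) by simp
  next
    case False
    then obtain i j R where M: "M = {#i, Suc j#} + R" and ij: "i < j" by (rule not_balanced_split)
    define M' where "M' = {#Suc i, j#} + R"
    have "(Suc i) * (Suc i) + j * j < i * i + Suc j * Suc j" using ij by simp
    then have "\<Sum>\<^sub># (image_mset (\<lambda>x. x * x) M') < \<Sum>\<^sub># (image_mset (\<lambda>x. x * x) M)"
      by (simp add: M M'_def)
    moreover have "size M' = size N" "\<Sum>\<^sub># M' = \<Sum>\<^sub># N" using less.prems by (auto simp: M M'_def)
    moreover have "\<And>x. x \<in># M' \<Longrightarrow> 1 \<le> x" using less.prems(3) ij by (auto simp: M M'_def)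
    ultimately have IH: "\<forall>x\<in>#M'. valid x" "legsum M' \<le> legsum N" using less.hyps by blast+
    have v: "valid (Suc i)" "valid j" "\<And>x. x \<in># R \<Longrightarrow> valid x" using IH(1) by (auto simp: M'_def)
    have R: "0 \<le> legsum R" using v(3) by (rule legsum_nonneg)
    have le: "s (Suc i) + s j \<le> L + \<alpha>" using IH(2) N(4) R by (simp add: M'_def del: leg.simps)
    \<comment> \<open>The leg of length i + 1 takes more than \<alpha> of the total L + \<alpha>.
      This gives the one denominator still missing for length j + 1.\<close>
    have "s j < L" using le leg_gt_alpha[OF v(1)] by (simp del: leg.simps)
    then have vj: "valid (Suc j)" using v by (simp add: valid_Suc)
    have "legsum M \<le> legsum M'"
      using shift_le[OF ij vj le] by (simp add: M M'_def del: leg.simps)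
    moreover have "valid i" using v(1) by (simp add: valid_Suc)
    ultimately show ?thesis using IH v vj by (auto simp: M simp del: leg.simps)
  qed
qed

text \<open>\<open>S\<close> is the total weight of the edges hanging at a vertex, \<open>hs\<close> the lengths of one descending path
  per such edge, \<open>ls\<close> the lengths of the remaining paths of a decomposition of the hanging edges into
  descending paths ending in pendant edges, and \<open>z\<close> is the $k$-th power of the ratio between
  the eigenvector at this vertex and its maximum. Detaching the paths in \<open>ls\<close> and moving them to the
  root is what the last condition compares.\<close>
definition hanging :: "real \<Rightarrow> real \<Rightarrow> nat multiset \<Rightarrow> nat multiset \<Rightarrow> bool" where
  "hanging z S hs ls \<longleftrightarrow>
     (\<forall>h\<in>#hs. 1 \<le> h \<and> valid h \<and> z * (s h - \<alpha>) \<le> L - s (h - 1)) \<and> (\<forall>h\<in>#ls. 1 \<le> h) \<and>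
     legsum hs \<le> S \<and> (hs = {#} \<longrightarrow> ls = {#}) \<and>
     (if ls = {#} then S = legsum hs else z * S < z * legsum hs + legsum ls)"

lemma hanging_empty: "hanging z 0 {#} {#}"
  by (simp add: hanging_def)

lemma hanging_add:
  assumes "hanging z S hs ls" "hanging z S' hs' ls'"
  shows "hanging z (S + S') (hs + hs') (ls + ls')"
proof -
  have "z * (S + S') < z * legsum (hs + hs') + legsum (ls + ls')" if "ls + ls' \<noteq> {#}"
  proof (cases "ls = {#}")
    case True
    then show ?thesis using assms that by (auto simp: hanging_def algebra_simps)
  next
    case False
    then show ?thesis using assms by (cases "ls' = {#}") (auto simp: hanging_def algebra_simps)
  qed
  then show ?thesis using assms by (auto simp: hanging_def)
qed

text \<open>Divided by the product, this is the tangent inequality for the convex function of S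
  given by the reciprocal of the product of all L - S u, in the relative increments
  \<open>r\<close>. It follows from 1 + t <= exp t, used for each factor and for minus the
  sum.\<close>

lemma one_minus_sum_mult_prod_le:
  fixes r :: "'b \<Rightarrow> real"
  assumes "finite A" "\<And>u. u \<in> A \<Longrightarrow> 0 \<le> r u"
  shows "(1 - sum r A) * (\<Prod>u\<in>A. 1 + r u) \<le> 1"
    and "0 < sum r A \<Longrightarrow> (1 - sum r A) * (\<Prod>u\<in>A. 1 + r u) < 1"
proof -
  have P: "0 < (\<Prod>u\<in>A. 1 + r u)" using assms(2) by (intro prod_pos) force
  have "(\<Prod>u\<in>A. 1 + r u) \<le> (\<Prod>u\<in>A. exp (r u))"
    using assms(2) by (intro prod_mono) (auto simp: exp_ge_add_one_self intro: order_trans[of 0 "1 + _"])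
  then have Pe: "(\<Prod>u\<in>A. 1 + r u) \<le> exp (sum r A)" by (simp add: exp_sum assms(1))
  have e: "exp (- sum r A) * exp (sum r A) = 1" by (simp flip: exp_add)
  show "(1 - sum r A) * (\<Prod>u\<in>A. 1 + r u) \<le> 1"
  proof -
    have "(1 - sum r A) * (\<Prod>u\<in>A. 1 + r u) \<le> exp (- sum r A) * (\<Prod>u\<in>A. 1 + r u)"
      using P exp_ge_add_one_self[of "- sum r A"] by (intro mult_right_mono) auto
    also have "\<dots> \<le> exp (- sum r A) * exp (sum r A)" using Pe by simp
    finally show ?thesis using e by simp
  qed
  show "(1 - sum r A) * (\<Prod>u\<in>A. 1 + r u) < 1" if "0 < sum r A"
  proof -
    have "(1 - sum r A) * (\<Prod>u\<in>A. 1 + r u) < exp (- sum r A) * (\<Prod>u\<in>A. 1 + r u)"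
      using P that exp_minus_greater[of "sum r A"] by (intro mult_strict_right_mono) auto
    also have "\<dots> \<le> exp (- sum r A) * exp (sum r A)" using Pe by simp
    finally show ?thesis using e by simp
  qed
qed

text \<open>The passage from the lower vertices \<open>A\<close> of an edge to its upper vertex,
  where \<open>G\<close> is the value of g. The path \<open>h1\<close> at \<open>u1\<close> is
  prolonged through the edge and all others are detached. By convexity the loss at the upper vertex
  is at most its linearisation, whose coefficient at \<open>u\<close>, multiplied by
  \<open>zv\<close>, is \<open>z u\<close>, because zv G = z u (L - S u). As \<open>z u\<close> is
  at most 1, the detached paths bring at least this much at the root.\<close>

lemma hanging_edge:
  fixes S z :: "'b \<Rightarrow> real" and hs ls :: "'b \<Rightarrow> nat multiset"
  assumes A: "finite A" "u1 \<in> A" and c: "c * L ^ (card A - 1) = G * (\<Prod>u\<in>A. L - S u)"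
    and zv: "0 < zv" and G: "0 < G"
    and u: "\<And>u. u \<in> A \<Longrightarrow> S u < L" "\<And>u. u \<in> A \<Longrightarrow> 0 < z u" "\<And>u. u \<in> A \<Longrightarrow> z u \<le> 1"
      "\<And>u. u \<in> A \<Longrightarrow> zv * G = z u * (L - S u)"
    and hang: "\<And>u. u \<in> A \<Longrightarrow> hanging (z u) (S u) (hs u) (ls u)"
    and h1: "h1 \<in># hs u1 \<or> h1 = 0 \<and> (\<forall>u\<in>A. hs u = {#})"
  shows "hanging zv (\<alpha> + G) {#Suc h1#}
    ((hs u1 - {#h1#}) + ls u1 + (\<Sum>u\<in>A - {u1}. hs u + ls u))"
proof -
  define R where "R = (hs u1 - {#h1#}) + ls u1 + (\<Sum>u\<in>A - {u1}. hs u + ls u)"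
  \<comment> \<open>The weights after detaching: only the path to be prolonged is left, at
    \<open>u1\<close>.\<close>
  define S' where "S' u = (if u = u1 then s h1 else 0)" for u
  define T where "T u = (if u = u1 then hs u - {#h1#} else hs u) + ls u" for u
  have RT: "R = (\<Sum>u\<in>A. T u)"
  proof -
    have "(\<Sum>u\<in>A. T u) = T u1 + (\<Sum>u\<in>A - {u1}. T u)" using A by (rule sum.remove)
    also have "(\<Sum>u\<in>A - {u1}. T u) = (\<Sum>u\<in>A - {u1}. hs u + ls u)" by (intro sum.cong) (auto simp: T_def)
    finally show ?thesis by (simp add: R_def T_def)
  qed
  have hs: "1 \<le> h \<and> valid h" if "u \<in> A" "h \<in># hs u" for u h using hang[OF that(1)] that(2) by (auto simp: hanging_def)
  have ls: "1 \<le> h" if "u \<in> A" "h \<in># ls u" for u h using hang[OF that(1)] that(2) by (auto simp: hanging_def)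
  have vh1: "valid h1" using h1 hs A(2) by auto
  have hsS: "legsum (hs u) \<le> S u" and lsemp: "hs u = {#} \<Longrightarrow> ls u = {#}" if "u \<in> A" for u
    using hang[OF that] by (auto simp: hanging_def)
  have sumsT: "legsum (T u) = legsum (hs u) - S' u + legsum (ls u)" if "u \<in> A" for u
  proof (cases "u = u1 \<and> h1 \<in># hs u1")
    case True
    then have "hs u = add_mset h1 (hs u - {#h1#})" by simp
    then have "legsum (hs u) = s h1 + legsum (hs u - {#h1#})" by (metis image_mset_add_mset sum_mset.add_mset)
    moreover have "T u = (hs u - {#h1#}) + ls u" unfolding T_def using True by presburger
    then have "legsum (T u) = legsum (hs u - {#h1#}) + legsum (ls u)"
      by (simp only: image_mset_union sum_mset.union)
    ultimately show ?thesis using True by (simp add: S'_def)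
  next
    case False
    then show ?thesis using h1 that by (auto simp: T_def S'_def)
  qed
  have rest: "0 \<le> legsum (hs u) - S' u" if "u \<in> A" for u
  proof (cases "u = u1 \<and> h1 \<in># hs u1")
    case True
    then have "hs u = add_mset h1 (hs u - {#h1#})" by simp
    then have "legsum (hs u) = s h1 + legsum (hs u - {#h1#})" by (metis image_mset_add_mset sum_mset.add_mset)
    moreover have "0 \<le> legsum (hs u - {#h1#})" using hs that by (intro legsum_nonneg) (auto dest: in_diffD)
    ultimately show ?thesis using True by (simp add: S'_def)
  next
    case False
    then have "S' u = 0" using h1 by (auto simp: S'_def)
    then show ?thesis using legsum_nonneg[of "hs u"] hs[OF that] by simp
  qed
  have S'S: "S' u \<le> S u" if "u \<in> A" for u using hsS[OF that] rest[OF that] by linarith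
  \<comment> \<open>Chosen so that L - S' u = (L - S u) (1 + r u). Thus \<open>P\<close> is the
    factor by which detaching lowers the value of the edge, and G / P belongs to a leg of length h1
    + 1.\<close>
  define r where "r u = (S u - S' u) / (L - S u)" for u
  have r0: "0 \<le> r u" if "u \<in> A" for u using S'S[OF that] u(1)[OF that] by (simp add: r_def)
  define P where "P = (\<Prod>u\<in>A. 1 + r u)"
  have "(\<Prod>u\<in>A. 1) \<le> P" unfolding P_def using r0 by (intro prod_mono) auto
  then have P1: "1 \<le> P" by simp
  have "(\<Prod>u\<in>A. L - S' u) = (\<Prod>u\<in>A. (L - S u) * (1 + r u))"
  proof (rule prod.cong[OF refl])
    fix w assume "w \<in> A"
    then have "L - S w \<noteq> 0" using u(1)[of w] by simp
    then show "L - S' w = (L - S w) * (1 + r w)" by (simp add: r_def distrib_left)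
  qed
  then have prodS': "(\<Prod>u\<in>A. L - S' u) = (\<Prod>u\<in>A. L - S u) * P" by (simp add: prod.distrib P_def)
  have "(\<Prod>u\<in>A. L - S' u) = (L - S' u1) * (\<Prod>u\<in>A - {u1}. L - S' u)" using A by (rule prod.remove)
  also have "(\<Prod>u\<in>A - {u1}. L - S' u) = (\<Prod>u\<in>A - {u1}. L)" by (intro prod.cong) (auto simp: S'_def)
  also have "\<dots> = L ^ (card A - 1)" using A by (simp add: card_Diff_singleton)
  finally have "(L - s h1) * L ^ (card A - 1) = (\<Prod>u\<in>A. L - S u) * P"
    using prodS' by (simp add: S'_def)
  then have "c * (P * L ^ (card A - 1)) = G * (L - s h1) * L ^ (card A - 1)"
    using c by (metis (no_types, lifting) mult.assoc mult.commute)
  then have cP: "c * P = G * (L - s h1)" using L_pos by (simp add: mult.assoc[symmetric])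
  have sh1: "s h1 \<le> S u1" using S'S[OF A(2)] by (simp add: S'_def)
  then have h1L: "s h1 < L" using u(1)[OF A(2)] by simp
  have sSuc: "s (Suc h1) = \<alpha> + G / P" using cP h1L P1 by (simp add: field_simps)
  have GP: "G / P \<le> G" using P1 G by (simp add: field_simps)
  have sumr: "zv * (G * sum r A) = (\<Sum>u\<in>A. z u * (S u - S' u))"
  proof -
    have "zv * (G * sum r A) = (\<Sum>u\<in>A. zv * G * r u)" by (simp add: sum_distrib_left mult.assoc)
    also have "\<dots> = (\<Sum>u\<in>A. z u * (S u - S' u))"
    proof (rule sum.cong[OF refl])
      fix w assume w: "w \<in> A"
      then show "zv * G * r w = z w * (S w - S' w)" using u(1)[OF w] unfolding u(4)[OF w] by (simp add: r_def)
    qed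
    finally show ?thesis .
  qed
  have tangent: "zv * (G - G / P) \<le> (\<Sum>u\<in>A. z u * (S u - S' u))"
  proof -
    have "(1 - sum r A) * P \<le> 1" unfolding P_def using A(1) r0 by (rule one_minus_sum_mult_prod_le(1))
    then have "G * ((1 - sum r A) * P) \<le> G * 1" using G by (intro mult_left_mono) auto
    then have "G - G / P \<le> G * sum r A" using P1 by (simp add: field_simps)
    then show ?thesis using zv unfolding sumr[symmetric] by simp
  qed
  have tangent_strict: "zv * (G - G / P) < (\<Sum>u\<in>A. z u * (S u - S' u))" if ne: "\<exists>u\<in>A. S u \<noteq> S' u"
  proof -
    obtain w where w: "w \<in> A" "S w \<noteq> S' w" using ne by blast
    then have "0 < r w" using S'S[OF w(1)] u(1)[OF w(1)] by (simp add: r_def)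
    then have "0 < sum r A" using A(1) w(1) r0 by (intro sum_pos2) auto
    then have "(1 - sum r A) * P < 1" unfolding P_def 
      using one_minus_sum_mult_prod_le(2)[of A r] A(1) r0 \<open>0 < sum r A\<close> by blast
    then have "G * ((1 - sum r A) * P) < G * 1" using G by (intro mult_strict_left_mono) auto
    then have "G - G / P < G * sum r A" using P1 by (simp add: field_simps)
    then show ?thesis using zv unfolding sumr[symmetric] by simp
  qed
  have sumT: "legsum R = (\<Sum>u\<in>A. legsum (T u))"
    unfolding RT using A(1) by (induction A rule: finite_induct) auto
  have zT: "z u * (S u - S' u) \<le> legsum (T u)" if w: "u \<in> A" for u
  proof -
    have "z u * S u \<le> z u * legsum (hs u) + legsum (ls u)"
      using hang[OF w] by (cases "ls u = {#}") (auto simp: hanging_def)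
    then have "z u * (S u - S' u) \<le> z u * (legsum (hs u) - S' u) + legsum (ls u)" by (simp add: algebra_simps)
    also have "\<dots> \<le> legsum (hs u) - S' u + legsum (ls u)"
      using mult_right_mono[OF u(3)[OF w] rest[OF w]] by simp
    finally show ?thesis using sumsT[OF w] by simp
  qed
  have main: "if R = {#} then G = G / P else zv * (G - G / P) < legsum R"
  proof (cases "R = {#}")
    case True
    have T0: "T w = {#}" if w: "w \<in> A" for w
    proof -
      have "set_mset (T w) \<subseteq> set_mset R" using A(1) w unfolding RT by (auto simp: set_mset_sum)
      then show ?thesis using True by simp
    qed
    have "S w = S' w" if w: "w \<in> A" for w
    proof -
      have "ls w = {#}" using T0[OF w] by (simp add: T_def)
      then have "S w = legsum (hs w)" using hang[OF w] by (simp add: hanging_def)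
      then show ?thesis using sumsT[OF w] T0[OF w] \<open>ls w = {#}\<close> by simp
    qed
    then have "P = 1" unfolding P_def r_def by simp
    then show ?thesis using True by simp
  next
    case False
    show ?thesis
    proof (cases "\<exists>u\<in>A. S u \<noteq> S' u")
      case True
      have "(\<Sum>u\<in>A. z u * (S u - S' u)) \<le> legsum R" unfolding sumT using zT by (rule sum_mono)
      then show ?thesis using tangent_strict[OF True] False by simp
    next
      \<comment> \<open>No weight below the edge changes, so strictness has to come from further
        down: only \<open>u1\<close> carries anything, all of \<open>R\<close> was detached earlier,
        and the strict inequality in \<open>hanging\<close> at \<open>u1\<close> makes its total
        positive.\<close>
      case eq: False
      have other: "hs w = {#} \<and> ls w = {#}" if w: "w \<in> A" "w \<noteq> u1" for w
      proof -
        have "legsum (hs w) \<le> 0" using hsS[OF w(1)] eq w by (auto simp: S'_def)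
        then have "hs w = {#}" using legsum_pos[of "hs w"] hs[OF w(1)] by (meson linorder_not_less)
        then show ?thesis using lsemp[OF w(1)] by simp
      qed
      have S1: "S u1 = s h1" using eq A(2) by (auto simp: S'_def)
      have T1: "hs u1 - {#h1#} = {#}" if "h1 \<in># hs u1"
      proof (rule ccontr)
        assume ne: "hs u1 - {#h1#} \<noteq> {#}"
        have "0 < legsum (hs u1 - {#h1#})" using ne hs[OF A(2)] by (intro legsum_pos) (auto dest: in_diffD)
        moreover have "hs u1 = add_mset h1 (hs u1 - {#h1#})" using that by simp
        then have "legsum (hs u1) = s h1 + legsum (hs u1 - {#h1#})" by (metis image_mset_add_mset sum_mset.add_mset)
        ultimately show False using hsS[OF A(2)] S1 by simp
      qed
      have T1': "hs u1 - {#h1#} = {#}" using T1 h1 A(2) by auto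
      have "R = ls u1" using other T1' by (simp add: R_def)
      then have lsne: "ls u1 \<noteq> {#}" using False by simp
      have sh: "legsum (hs u1) = s h1"
        using sumsT[OF A(2)] T1' by (simp add: T_def S'_def)
      have "z u1 * S u1 < z u1 * legsum (hs u1) + legsum (ls u1)" using hang[OF A(2)] lsne by (simp add: hanging_def)
      then have "0 < legsum R" using S1 sh \<open>R = ls u1\<close> by simp
      moreover have "(\<Sum>u\<in>A. z u * (S u - S' u)) = 0" using eq by (intro sum.neutral) auto
      ultimately show ?thesis using tangent False by simp
    qed
  qed
  \<comment> \<open>This bound is carried along for the equality case: at the root, where the ratio
    is 1, it becomes c <= (L - s h1)^2 and makes balancing moves strict.\<close>
  have "zv * G \<le> L - s h1"
  proof -
    have "zv * G = z u1 * (L - S u1)" using u(4)[OF A(2)] .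
    also have "\<dots> \<le> 1 * (L - S u1)" using u(1,3)[OF A(2)] by (intro mult_right_mono) auto
    finally show ?thesis using sh1 by simp
  qed
  moreover have "zv * (G / P) \<le> zv * G" using GP zv by (intro mult_left_mono) auto
  ultimately have head: "zv * (s (Suc h1) - \<alpha>) \<le> L - s h1" unfolding sSuc by simp
  have R1: "1 \<le> h" if h: "h \<in># R" for h
  proof -
    obtain w where w: "w \<in> A" "h \<in># T w" using h A(1) unfolding RT by (auto simp: set_mset_sum)
    then show ?thesis using hs[OF w(1)] ls[OF w(1)] by (auto simp: T_def split: if_splits dest: in_diffD)
  qed
  have "hanging zv (\<alpha> + G) {#Suc h1#} R"
    unfolding hanging_def
  proof (intro conjI)
    show "\<forall>h\<in>#{#Suc h1#}. 1 \<le> h \<and> valid h \<and> zv * (s h - \<alpha>) \<le> L - s (h - 1)"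
      using vh1 h1L head by (simp add: valid_Suc del: leg.simps)
    show "\<forall>h\<in>#R. 1 \<le> h" using R1 by blast
    show "legsum {#Suc h1#} \<le> \<alpha> + G" using sSuc GP by (simp del: leg.simps)
    show "if R = {#} then \<alpha> + G = legsum {#Suc h1#} else zv * (\<alpha> + G) < zv * legsum {#Suc h1#} + legsum R"
      using main sSuc by (cases "R = {#}") (simp_all del: leg.simps add: algebra_simps)
  qed simp
  then show ?thesis by (simp add: R_def)
qed

end

section \<open>Edge labels of a positive eigenvector\<close>

locale positive_eigen =
  fixes k :: nat and \<alpha> :: real and H :: "'a hgraph" and \<mu> :: real and x :: "'a \<Rightarrow> real"
  assumes unif: "uniform k H" and k: "2 \<le> k" and \<alpha>: "0 \<le> \<alpha>" "\<alpha> < 1"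
    and eig: "positive_eigenvector k \<alpha> H \<mu> x"
begin

definition g :: "'a \<Rightarrow> 'a set \<Rightarrow> real" where
  "g v e = (1 - \<alpha>) * (\<Prod>u\<in>e. x u) / x v ^ k"

lemma finite_verts: "finite (verts H)" and edge_subset: "e \<in> edges H \<Longrightarrow> e \<subseteq> verts H"
  and card_edge: "e \<in> edges H \<Longrightarrow> card e = k"
  using unif by (auto simp: uniform_def hypergraph_def)

lemma finite_edges: "finite (edges H)"
  using finite_verts edge_subset by (meson PowI finite_Pow_iff finite_subset subsetI)

lemma finite_edge: "e \<in> edges H \<Longrightarrow> finite e"
  using edge_subset finite_verts finite_subset by blast

lemma x_pos: "v \<in> verts H \<Longrightarrow> 0 < x v"
  using eig by (auto simp: positive_eigenvector_def)

lemma prod_x_pos: "e \<in> edges H \<Longrightarrow> 0 < (\<Prod>u\<in>e. x u)"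
  using edge_subset x_pos by (intro prod_pos) blast

lemma g_pos: "e \<in> edges H \<Longrightarrow> v \<in> e \<Longrightarrow> 0 < g v e"
  using \<alpha> x_pos[of v] edge_subset[of e] prod_x_pos[of e] unfolding g_def
  by (intro divide_pos_pos mult_pos_pos zero_less_power) auto

text \<open>Both sides are 1 - \<alpha> times the product of \<open>x\<close> over the edge; this
  common value is why the derivative factors telescope.\<close>

lemma g_ratio: "e \<in> edges H \<Longrightarrow> v \<in> e \<Longrightarrow> u \<in> e \<Longrightarrow> x v ^ k * g v e = x u ^ k * g u e"
proof -
  assume e: "e \<in> edges H" "v \<in> e" "u \<in> e"
  then have "x v ^ k \<noteq> 0" "x u ^ k \<noteq> 0" using x_pos edge_subset by fastforce+
  then show ?thesis by (simp add: g_def)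
qed

lemma g_prod: "e \<in> edges H \<Longrightarrow> (\<Prod>v\<in>e. g v e) = (1 - \<alpha>) ^ k"
proof -
  assume e: "e \<in> edges H"
  have "(\<Prod>v\<in>e. g v e) = ((1 - \<alpha>) * (\<Prod>u\<in>e. x u)) ^ k / (\<Prod>v\<in>e. x v) ^ k"
    unfolding g_def prod_dividef prod_constant card_edge[OF e] by (simp add: prod_power_distrib)
  then show ?thesis using prod_x_pos[OF e] by (simp add: power_mult_distrib)
qed

lemma g_sum:
  assumes v: "v \<in> verts H"
  shows "(\<Sum>e\<in>{e\<in>edges H. v \<in> e}. \<alpha> + g v e) = \<mu>"
proof -
  have "x v ^ (k - 1) \<noteq> 0" using x_pos[OF v] by simp
  have kk: "x v ^ k = x v * x v ^ (k - 1)" using k by (metis power_eq_if not_numeral_le_zero)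
  have "g v e = (1 - \<alpha>) * (\<Prod>u\<in>e - {v}. x u) / x v ^ (k - 1)" if "e \<in> {e\<in>edges H. v \<in> e}" for e
  proof -
    have "(\<Prod>u\<in>e. x u) = x v * (\<Prod>u\<in>e - {v}. x u)" using that finite_edge by (intro prod.remove) auto
    then show ?thesis using x_pos[OF v] by (simp add: g_def kk)
  qed
  then have "(\<Sum>e\<in>{e\<in>edges H. v \<in> e}. g v e) = (1 - \<alpha>) * nbsum (edges H) x v / x v ^ (k - 1)"
    by (simp add: nbsum_def sum_distrib_left sum_divide_distrib)
  then have "(\<Sum>e\<in>{e\<in>edges H. v \<in> e}. \<alpha> + g v e) =
      (\<alpha> * real (degree H v) * x v ^ (k - 1) + (1 - \<alpha>) * nbsum (edges H) x v) / x v ^ (k - 1)"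
    using x_pos[OF v] by (simp add: sum.distrib degree_def add_divide_distrib)
  also have "\<dots> = \<mu>" using eig v \<open>x v ^ (k - 1) \<noteq> 0\<close> by (auto simp: positive_eigenvector_def)
  finally show ?thesis .
qed

lemma g_sum_subset:
  assumes "v \<in> verts H" "C \<subseteq> {e\<in>edges H. v \<in> e}"
  shows "(\<Sum>e\<in>C. \<alpha> + g v e) \<le> \<mu>"
  unfolding g_sum[OF assms(1), symmetric] using finite_edges assms(2) \<alpha>(1)
  by (intro sum_mono2) (auto intro!: add_nonneg_nonneg less_imp_le[OF g_pos])

lemma g_le: "e \<in> edges H \<Longrightarrow> v \<in> e \<Longrightarrow> \<alpha> + g v e \<le> \<mu>"
  using g_sum_subset[of v "{e}"] edge_subset[of e] by auto

lemma g_le2: "e \<in> edges H \<Longrightarrow> v \<in> e \<Longrightarrow> e' \<in> edges H \<Longrightarrow> v \<in> e' \<Longrightarrow> e \<noteq> e' \<Longrightarrow>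
  (\<alpha> + g v e) + (\<alpha> + g v e') \<le> \<mu>"
  using g_sum_subset[of v "{e, e'}"] edge_subset[of e] by auto

lemma mu_gt_alpha: "edges H \<noteq> {} \<Longrightarrow> \<alpha> < \<mu>"
proof -
  assume "edges H \<noteq> {}"
  then obtain e where e: "e \<in> edges H" by blast
  then obtain v where "v \<in> e" using card_edge k by fastforce
  then show ?thesis using g_le[OF e] g_pos[OF e] by fastforce
qed

end

section \<open>The legs of the extremal hypertree\<close>

lemma Tedge_inj:
  assumes "Tedge k j i = Tedge k j' i'" "1 \<le> j" "1 \<le> i" "1 \<le> j'" "1 \<le> i'"
  shows "j = j' \<and> i = i'"
proof -
  have "(j, i, 0) \<in> Tedge k j' i'" unfolding assms(1)[symmetric] by (simp add: Tedge_def)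
  moreover have "(j', i', 0) \<in> Tedge k j i" unfolding assms(1) by (simp add: Tedge_def)
  ultimately show ?thesis using assms(2-) by (auto simp: Tedge_def split: if_splits)
qed

lemma card_Tedge:
  assumes "2 \<le> k" "1 \<le> j" "1 \<le> i"
  shows "card (Tedge k j i) = k"
proof -
  have "{(j, i, r) | r. r \<le> k - 2} = (\<lambda>r. (j, i, r)) ` {..k - 2}" by auto
  then have "finite {(j, i, r) | r. r \<le> k - 2}" "card {(j, i, r) | r. r \<le> k - 2} = k - 1"
    using assms by (auto simp: card_image inj_on_def)
  then show ?thesis using assms by (auto simp: Tedge_def)
qed

lemma uniform_T_mtk: "2 \<le> k \<Longrightarrow> uniform k (T_mtk m t k)"
  unfolding uniform_def T_mtk_spider using hypergraph_spider card_Tedge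
  by (auto simp: edges_def spider_edges_def)

lemma verts_T_mtk: "p \<in> verts (T_mtk m t k) \<longleftrightarrow> p = (0, 0, 0) \<or>
    (\<exists>j i r. p = (j, i, r) \<and> 1 \<le> j \<and> j \<le> t \<and> 1 \<le> i \<and> i \<le> Tlen m t j \<and> r \<le> k - 2)"
proof -
  have "Tlens m t ! (j - Suc 0) = Tlen m t j" if "Suc 0 \<le> j" "j \<le> t" for j
    using that by (auto simp: Tlens_def nth_map_upt simp del: upt_Suc)
  then show ?thesis
    by (cases p) (auto simp: T_mtk_spider verts_def spider_verts_def Tlens_def simp del: upt_Suc)
qed

lemma edges_T_mtk: "edges (T_mtk m t k) = {Tedge k j i | j i. 1 \<le> j \<and> j \<le> t \<and> 1 \<le> i \<and> i \<le> Tlen m t j}"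
  by (simp add: edges_def T_mtk_def Tedges_def)

text \<open>A set that no edge crosses contains all or nothing of each edge; following a leg
  inwards, every vertex agrees with the centre.\<close>

lemma cut_connected_T_mtk: "cut_connected (T_mtk m t k)"
  unfolding cut_connected_def
proof (intro allI impI, rule ccontr)
  let ?T = "T_mtk m t k"
  fix A assume A: "A \<subseteq> verts ?T \<and> A \<noteq> {} \<and> A \<noteq> verts ?T"
    and no: "\<not> (\<exists>e\<in>edges ?T. e \<inter> A \<noteq> {} \<and> e \<inter> (verts ?T - A) \<noteq> {})"
  have closed: "p \<in> A \<longleftrightarrow> q \<in> A" if "1 \<le> j" "j \<le> t" "1 \<le> i" "i \<le> Tlen m t j" "p \<in> Tedge k j i" "q \<in> Tedge k j i" for p q j i
  proof -
    have e: "Tedge k j i \<in> edges ?T" using that by (auto simp: edges_T_mtk)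
    have "Tedge k j i \<subseteq> verts ?T"
      using hypergraph_spider[of k "Tlens m t"] e unfolding T_mtk_spider[symmetric] by (auto simp: hypergraph_def)
    then show ?thesis using no e that by blast
  qed
  have *: "(j, i, r) \<in> A \<longleftrightarrow> (0, 0, 0) \<in> A" if "1 \<le> j" "j \<le> t" "1 \<le> i" "i \<le> Tlen m t j" "r \<le> k - 2" for j i r
    using that(3,4,5)
  proof (induction i arbitrary: r rule: dec_induct)
    case base
    then show ?case using that by (intro closed[of j 1]) (auto simp: Tedge_def)
  next
    case (step i)
    have "(j, Suc i, r) \<in> A \<longleftrightarrow> (j, i, 0) \<in> A"
      using that step by (intro closed[of j "Suc i"]) (auto simp: Tedge_def)
    then show ?case using step by simp
  qed
  then have "p \<in> A \<longleftrightarrow> (0, 0, 0) \<in> A" if "p \<in> verts ?T" for p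
    using that unfolding verts_T_mtk by auto
  then show False using A by blast
qed

text \<open>Here \<open>L\<close> and \<open>c\<close> may come from another hypergraph, whereas
  \<mu> is the eigenvalue of \<open>T_mtk m t k\<close>, at most L + \<alpha>. From the free end of
  each leg inwards, the values \<alpha> + g of the eigenvector dominate the recursion run with
  \<open>L\<close>. This keeps the denominators positive and bounds the sum at the centre by
  \<mu>.\<close>

lemma (in leg_weights) T_mtk_legs:
  assumes k: "2 \<le> k" and t: "1 \<le> t" "t \<le> m" and \<alpha>: "\<alpha> < 1"
    and eig: "positive_eigenvector k \<alpha> (T_mtk m t k) \<mu> x" and \<mu>: "\<mu> \<le> L + \<alpha>"
    and c: "c * L ^ (k - 2) = (1 - \<alpha>) ^ k"
  shows "(\<forall>j\<in>{1..t}. valid (Tlen m t j)) \<and> (\<Sum>j\<in>{1..t}. s (Tlen m t j)) \<le> \<mu>"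
proof -
  interpret positive_eigen k \<alpha> "T_mtk m t k" \<mu> x
    using uniform_T_mtk[OF k] k alpha_nonneg \<alpha> eig by unfold_locales
  have Tpos: "1 \<le> Tlen m t j" for j
  proof -
    have "1 \<le> m div t" using t by (simp add: Suc_le_eq div_greater_zero_iff)
    then show ?thesis by (simp add: Tlen_def)
  qed
  define w where "w j i = (if i = 0 then (0, 0, 0) else (j, i, 0 :: nat))" for j i :: nat
  have edge: "Tedge k j i \<in> edges (T_mtk m t k)" if "j \<in> {1..t}" "1 \<le> i" "i \<le> Tlen m t j" for j i
    using that by (auto simp: edges_T_mtk)
  have wi: "w j i \<in> Tedge k j i" "w j (i - 1) \<in> Tedge k j i" if "1 \<le> i" for j i
    using that by (auto simp: w_def Tedge_def)
  have leg: "n \<le> Tlen m t j \<longrightarrow> valid n \<and>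
      (0 < n \<longrightarrow> s n \<le> \<alpha> + g (w j (Tlen m t j - n)) (Tedge k j (Suc (Tlen m t j - n))))"
    if j: "j \<in> {1..t}" for j n
  proof (induction n)
    case (Suc n)
    show ?case
    proof (rule impI)
      assume n: "Suc n \<le> Tlen m t j"
      \<comment> \<open>Counted from the free end, \<open>n\<close> edges lie beyond edge
        \<open>i\<close>: a leg of length \<open>n\<close> hangs at its outer end
        \<open>w j i\<close>, and its inner end is \<open>w j (i - 1)\<close>.\<close>
      define i where "i = Tlen m t j - n"
      have i: "1 \<le> i" "i \<le> Tlen m t j" "Tlen m t j - Suc n = i - 1" using n by (auto simp: i_def)
      have vn: "valid n" using Suc n by simp
      have e: "Tedge k j i \<in> edges (T_mtk m t k)" using edge[OF j] i by auto
      have gi: "g (w j i) (Tedge k j i) \<le> L - s n"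
      proof (cases "n = 0")
        case True
        then show ?thesis using g_le[OF e wi(1)[OF i(1)]] \<mu> by simp
      next
        case False
        have e': "Tedge k j (Suc i) \<in> edges (T_mtk m t k)" using edge[OF j] i n False by (auto simp: i_def)
        have ne: "Tedge k j i \<noteq> Tedge k j (Suc i)" using Tedge_inj[of k j i j "Suc i"] j i by auto
        have "(\<alpha> + g (w j i) (Tedge k j i)) + (\<alpha> + g (w j i) (Tedge k j (Suc i))) \<le> \<mu>"
          using wi[of i j] wi[of "Suc i" j] i by (intro g_le2 e e' ne) auto
        moreover have "s n \<le> \<alpha> + g (w j i) (Tedge k j (Suc i))" using Suc n False by (simp add: i_def)
        ultimately show ?thesis using \<mu> by linarith
      qed
      have gpos: "0 < g p (Tedge k j i)" if "p \<in> Tedge k j i" for p using g_pos[OF e that] .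
      have sn: "s n < L" using gi gpos[OF wi(1)[OF i(1)]] by linarith
      define A where "A = Tedge k j i - {w j (i - 1)} - {w j i}"
      have wne: "w j i \<noteq> w j (i - 1)" using i by (auto simp: w_def)
      have fin: "finite (Tedge k j i)" using finite_edge[OF e] .
      have cA: "card A = k - 2"
        using wi[OF i(1)] wne card_Tedge[OF k, of j i] j i by (simp add: A_def card_Diff_singleton_if)
      have "(1 - \<alpha>) ^ k = g (w j (i - 1)) (Tedge k j i) * (g (w j i) (Tedge k j i) * (\<Prod>p\<in>A. g p (Tedge k j i)))"
        unfolding g_prod[OF e, symmetric] A_def
        using prod.remove[OF fin wi(2)[OF i(1)], of "\<lambda>p. g p (Tedge k j i)"] fin wi(1)[OF i(1)] wne
          prod.remove[of "Tedge k j i - {w j (i - 1)}" "w j i" "\<lambda>p. g p (Tedge k j i)"] by simp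
      \<comment> \<open>The outer end contributes at most L - s n, and each of the k - 2 remaining
        vertices at most \<mu> - \<alpha> <= L, which leaves at least c / (L - s n) for the inner
        end.\<close>
      also have "\<dots> \<le> g (w j (i - 1)) (Tedge k j i) * ((L - s n) * (\<Prod>p\<in>A. L))"
      proof (intro mult_left_mono mult_mono gi prod_mono conjI)
        fix p assume "p \<in> A"
        then have p: "p \<in> Tedge k j i" by (simp add: A_def)
        show "0 \<le> g p (Tedge k j i)" using gpos[OF p] by simp
        show "g p (Tedge k j i) \<le> L" using g_le[OF e p] \<mu> by simp
      next
        show "0 \<le> L - s n" using sn by simp
        show "0 \<le> (\<Prod>p\<in>A. g p (Tedge k j i))"
          using gpos by (intro prod_nonneg) (auto simp: A_def intro: less_imp_le)
        show "0 \<le> g (w j (i - 1)) (Tedge k j i)" using gpos[OF wi(2)[OF i(1)]] by simp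
      qed
      also have "\<dots> = (g (w j (i - 1)) (Tedge k j i) * (L - s n)) * L ^ (k - 2)" by (simp add: cA)
      finally have "c \<le> g (w j (i - 1)) (Tedge k j i) * (L - s n)" using L_pos unfolding c[symmetric] by simp
      then have "c / (L - s n) \<le> g (w j (i - 1)) (Tedge k j i)" using sn by (simp add: divide_le_eq)
      then show "valid (Suc n) \<and> (0 < Suc n \<longrightarrow>
          s (Suc n) \<le> \<alpha> + g (w j (Tlen m t j - Suc n)) (Tedge k j (Suc (Tlen m t j - Suc n))))"
        using vn sn i by (simp add: valid_Suc)
    qed
  qed simp
  have legs: "valid (Tlen m t j) \<and> s (Tlen m t j) \<le> \<alpha> + g (0, 0, 0) (Tedge k j 1)" if "j \<in> {1..t}" for j
    using leg[OF that, of "Tlen m t j"] Tpos[of j] by (simp add: w_def)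
  have inj: "inj_on (\<lambda>j. Tedge k j 1) {1..t}" by (rule inj_onI) (use Tedge_inj in auto)
  have "(\<Sum>j\<in>{1..t}. s (Tlen m t j)) \<le> (\<Sum>j\<in>{1..t}. \<alpha> + g (0, 0, 0) (Tedge k j 1))"
    using legs by (intro sum_mono) blast
  also have "\<dots> = (\<Sum>e\<in>(\<lambda>j. Tedge k j 1) ` {1..t}. \<alpha> + g (0, 0, 0) e)" using inj by (simp add: sum.reindex)
  also have "\<dots> \<le> \<mu>"
    by (rule g_sum_subset) (use edge Tpos wi(2)[of 1] in \<open>auto simp: verts_T_mtk w_def\<close>)
  finally show ?thesis using legs by blast
qed

section \<open>Cutting a hypertree into descending paths\<close>

lemma grown_subset_verts:
  "grown r W F \<Longrightarrow> r \<in> V \<Longrightarrow> (\<And>e. e \<in> F \<Longrightarrow> e \<subseteq> V) \<Longrightarrow> W \<subseteq> V"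
  by (induction rule: grown.induct) auto

locale rooted_hypertree = positive_eigen +
  fixes r :: 'a
  assumes tree: "hypertree H" and r: "r \<in> verts H" and r_max: "\<And>v. v \<in> verts H \<Longrightarrow> x v \<le> x r"
    and r_degree: "2 \<le> degree H r"
begin

definition L :: real where "L = \<mu> - \<alpha>"
definition c :: real where "c = (1 - \<alpha>) ^ k / L ^ (k - 2)"

lemma L_pos: "0 < L"
proof -
  have "edges H \<noteq> {}" using r_degree by (auto simp: degree_def)
  then show ?thesis using mu_gt_alpha by (simp add: L_def)
qed

lemma c_L: "c * L ^ (k - 2) = (1 - \<alpha>) ^ k"
  using L_pos by (simp add: c_def)

sublocale leg_weights \<alpha> L c
  using \<alpha> L_pos by unfold_locales (auto simp: c_def)

definition ratio :: "'a \<Rightarrow> real" where "ratio v = (x v / x r) ^ k"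

lemma ratio_pos: "v \<in> verts H \<Longrightarrow> 0 < ratio v"
  using x_pos r by (simp add: ratio_def)

lemma ratio_le_1: "v \<in> verts H \<Longrightarrow> ratio v \<le> 1"
  unfolding ratio_def using x_pos[of v] x_pos[OF r] r_max[of v] by (intro power_le_one) auto

lemma ratio_g: "e \<in> edges H \<Longrightarrow> v \<in> e \<Longrightarrow> u \<in> e \<Longrightarrow> ratio v * g v e = ratio u * g u e"
  using g_ratio[of e v u] by (simp add: ratio_def power_divide)

definition weight :: "'a set set \<Rightarrow> 'a \<Rightarrow> real" where
  "weight F w = (\<Sum>e\<in>{e\<in>edges H - F. w \<in> e}. \<alpha> + g w e)"

definition pendants :: "'a set set" where "pendants = {e\<in>edges H. pendant_edge H e}"

text \<open>\<open>F\<close> is the set of edges not yet stripped and \<open>W\<close> its set of vertices; \<open>Y w\<close> and \<open>B w\<close> are the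
  vertices and edges of the stripped part hanging at \<open>w\<close>.\<close>
definition stripped :: "'a set \<Rightarrow> 'a set set \<Rightarrow> ('a \<Rightarrow> nat multiset) \<Rightarrow> ('a \<Rightarrow> nat multiset) \<Rightarrow>
    ('a \<Rightarrow> 'a set) \<Rightarrow> ('a \<Rightarrow> 'a set set) \<Rightarrow> bool" where
  "stripped W F hs ls Y B \<longleftrightarrow>
     (\<forall>w\<in>W. hanging (ratio w) (weight F w) (hs w) (ls w) \<and> size (hs w) = card {e\<in>edges H - F. w \<in> e} \<and>
        (ls w = {#} \<longrightarrow> is_spider k w (Y w) (B w) (hs w))) \<and>
     (\<Sum>w\<in>W. \<Sum>\<^sub># (hs w + ls w)) = card (edges H - F) \<and>
     (\<Sum>w\<in>W. size (hs w + ls w)) = card (pendants - F) \<and>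
     (\<Union>w\<in>W. Y w) = verts H \<and> (\<Union>w\<in>W. B w) = edges H - F \<and>
     (\<forall>w\<in>W. \<forall>w'\<in>W. w \<noteq> w' \<longrightarrow> Y w \<inter> Y w' = {})"

lemma stripped_start: "stripped (verts H) (edges H) (\<lambda>_. {#}) (\<lambda>_. {#}) (\<lambda>w. {w}) (\<lambda>_. {})"
proof -
  have "card (pendants - edges H) = 0" by (simp add: pendants_def Diff_eq_empty_iff[THEN iffD2] subset_eq)
  then show ?thesis
    unfolding stripped_def by (auto simp: weight_def hanging_empty is_spider_empty)
qed

text \<open>The edge grown last is stripped, and what hangs at its vertices other than
  \<open>v\<close> is rehung at \<open>v\<close>. These vertices lie outside \<open>W\<close>, so
  their other edges are already stripped and g there is \<open>L\<close> minus the weight.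
  Prolonging one path raises the total length by one; the number of paths grows only if nothing
  hangs below, which happens exactly when \<open>e\<close> is pendant.\<close>

lemma stripped_step:
  assumes st: "stripped (W \<union> e) (insert e F) hs ls Y B" and gr: "grown r W F" and v: "e \<inter> W = {v}"
    and F: "e \<notin> F" "insert e F \<subseteq> edges H"
  shows "\<exists>hs ls Y B. stripped W F hs ls Y B"
proof -
  define A where "A = e - {v}"
  have e: "e \<in> edges H" using F by blast
  have ve: "v \<in> e" and vW: "v \<in> W" using v by auto
  have We: "W \<union> e = W \<union> A" and WA: "W \<inter> A = {}" using v by (auto simp: A_def)
  have WV: "W \<subseteq> verts H" using grown_subset_verts[OF gr r] F edge_subset by blast
  have AV: "A \<subseteq> verts H" using edge_subset[OF e] by (auto simp: A_def)
  have finW: "finite W" and finA: "finite A" using WV AV finite_verts finite_subset by blast+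
  have cardA: "card A = k - 1" using ve card_edge[OF e] by (simp add: A_def card_Diff_singleton)
  have eA: "e = insert v A" and vA: "v \<notin> A" using ve by (auto simp: A_def)
  have finE: "finite C" if "C \<subseteq> edges H" for C using that finite_edges finite_subset by blast
  have diff: "edges H - F = insert e (edges H - insert e F)" using e F by blast
  have st_w: "\<forall>w\<in>W \<union> A. hanging (ratio w) (weight (insert e F) w) (hs w) (ls w) \<and>
        size (hs w) = card {c\<in>edges H - insert e F. w \<in> c} \<and>
        (ls w = {#} \<longrightarrow> is_spider k w (Y w) (B w) (hs w))"
    and st_edges: "(\<Sum>w\<in>W \<union> A. \<Sum>\<^sub># (hs w + ls w)) = card (edges H - insert e F)"
    and st_pend: "(\<Sum>w\<in>W \<union> A. size (hs w + ls w)) = card (pendants - insert e F)"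
    and st_Y: "(\<Union>w\<in>W \<union> A. Y w) = verts H" and st_B: "(\<Union>w\<in>W \<union> A. B w) = edges H - insert e F"
    and st_disj: "\<forall>w\<in>W \<union> A. \<forall>w'\<in>W \<union> A. w \<noteq> w' \<longrightarrow> Y w \<inter> Y w' = {}"
    using st unfolding stripped_def We by - (elim conjE, assumption)+
  have hang: "hanging (ratio w) (weight (insert e F) w) (hs w) (ls w)"
    and size: "size (hs w) = card {c\<in>edges H - insert e F. w \<in> c}"
    and spider: "ls w = {#} \<Longrightarrow> is_spider k w (Y w) (B w) (hs w)" if "w \<in> W \<union> A" for w
    using bspec[OF st_w that] by blast+
  have disj: "Y w \<inter> Y w' = {}" if "w \<in> W \<union> A" "w' \<in> W \<union> A" "w \<noteq> w'" for w w'
    using st_disj that by blast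
  have emp: "ls w = {#}" if "w \<in> W \<union> A" "hs w = {#}" for w
    using hang[OF that(1)] that(2) by (auto simp: hanging_def)
  have inc_u: "{c\<in>edges H. u \<in> c} = insert e {c\<in>edges H - insert e F. u \<in> c}" if "u \<in> A" for u
    using that WA grown_edge_subset[OF gr] e by (auto simp: A_def)
  have inc_v: "{c\<in>edges H - F. v \<in> c} = insert e {c\<in>edges H - insert e F. v \<in> c}"
    using e ve F by auto
  have inc_w: "{c\<in>edges H - F. w \<in> c} = {c\<in>edges H - insert e F. w \<in> c}" if "w \<in> W" "w \<noteq> v" for w
    using that v by auto
  have weight_v: "weight F v = weight (insert e F) v + (\<alpha> + g v e)"
    unfolding weight_def inc_v by (subst sum.insert) (auto intro: finE)
  have weight_w: "weight F w = weight (insert e F) w" if "w \<in> W" "w \<noteq> v" for w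
    unfolding weight_def inc_w[OF that] ..
  have weight_u: "g u e = L - weight (insert e F) u" if u: "u \<in> A" for u
  proof -
    have "u \<in> verts H" using AV u by blast
    then have "\<mu> = (\<Sum>c\<in>insert e {c\<in>edges H - insert e F. u \<in> c}. \<alpha> + g u c)"
      using g_sum[of u] unfolding inc_u[OF u] by simp
    also have "\<dots> = (\<alpha> + g u e) + weight (insert e F) u"
      unfolding weight_def by (rule sum.insert) (auto intro: finE)
    finally have "\<mu> = (\<alpha> + g u e) + weight (insert e F) u" .
    then show ?thesis unfolding L_def by linarith
  qed
  have deg_u: "degree H u = Suc (size (hs u))" if "u \<in> A" for u
    using that unfolding degree_def inc_u[OF that] size[OF UnI2[OF that]] by (subst card_insert_disjoint) (auto intro: finE)
  \<comment> \<open>At the root this is assumed; elsewhere an edge of \<open>F\<close> contains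
    \<open>v\<close> besides \<open>e\<close>. Hence if \<open>e\<close> is pendant, its vertex of
    degree at least 2 must be \<open>v\<close>.\<close>
  have deg_v: "2 \<le> degree H v"
  proof (cases "v = r")
    case True
    then show ?thesis using r_degree by simp
  next
    case False
    then obtain c where c: "c \<in> F" "v \<in> c" using grown_covered[OF gr vW] by blast
    then have "card {c, e} \<le> degree H v" unfolding degree_def using F ve finite_edges
      by (intro card_mono) auto
    moreover have "c \<noteq> e" using c F by auto
    ultimately show ?thesis by simp
  qed
  have pend: "e \<in> pendants \<longleftrightarrow> (\<forall>u\<in>A. hs u = {#})"
  proof
    assume "e \<in> pendants"
    then obtain v0 where v0: "v0 \<in> e" "\<And>u. u \<in> e - {v0} \<Longrightarrow> degree H u = 1"
      by (auto simp: pendants_def pendant_edge_def)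
    have "v0 = v" using v0(2)[of v] ve deg_v by force
    then show "\<forall>u\<in>A. hs u = {#}" using v0(2) deg_u by (auto simp: A_def)
  next
    assume "\<forall>u\<in>A. hs u = {#}"
    then have "\<forall>u\<in>e - {v}. degree H u = 1" using deg_u by (auto simp: A_def)
    then show "e \<in> pendants" using e ve deg_v unfolding pendants_def pendant_edge_def by blast
  qed
  have Ane: "A \<noteq> {}" using cardA k by auto
  \<comment> \<open>If nothing hangs below \<open>e\<close>, a new path starts and the prolonged
    length is 0. Otherwise the path is taken from some \<open>hs u1\<close>, whose members are still
    attached, not from the detached ones.\<close>
  obtain u1 h1 where u1: "u1 \<in> A" and h1: "h1 \<in># hs u1 \<or> h1 = 0 \<and> (\<forall>u\<in>A. hs u = {#})"
  proof (cases "\<forall>u\<in>A. hs u = {#}")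
    case True
    then show thesis using that Ane by blast
  next
    case False
    then show thesis using that by (metis multiset_nonemptyE)
  qed
  define R where "R = (hs u1 - {#h1#}) + ls u1 + (\<Sum>u\<in>A - {u1}. hs u + ls u)"
  have "hanging (ratio v) (\<alpha> + g v e) {#Suc h1#} R"
    unfolding R_def
  proof (rule hanging_edge[OF finA u1 _ _ _ _ _ _ _ _ h1, where S = "weight (insert e F)" and z = ratio])
    have "(\<Prod>u\<in>A. L - weight (insert e F) u) = (\<Prod>u\<in>A. g u e)" using weight_u by (intro prod.cong) auto
    moreover have "(\<Prod>u\<in>e. g u e) = g v e * (\<Prod>u\<in>A. g u e)" using finA vA eA by (metis prod.insert)
    moreover have "card A - 1 = k - 2" using cardA by simp
    ultimately show "c * L ^ (card A - 1) = g v e * (\<Prod>u\<in>A. L - weight (insert e F) u)"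
      using g_prod[OF e] c_L by simp
    show "0 < ratio v" using ratio_pos vW WV by blast
    show "0 < g v e" using g_pos[OF e ve] .
    fix u assume u: "u \<in> A"
    have ue: "u \<in> e" using u by (simp add: A_def)
    show "weight (insert e F) u < L" using weight_u[OF u] g_pos[OF e ue] by simp
    show "0 < ratio u" "ratio u \<le> 1" using ratio_pos ratio_le_1 u AV by auto
    show "ratio v * g v e = ratio u * (L - weight (insert e F) u)"
      using ratio_g[OF e ve ue] weight_u[OF u] by simp
    show "hanging (ratio u) (weight (insert e F) u) (hs u) (ls u)" using hang u by blast
  qed
  then have hang_v: "hanging (ratio v) (weight F v) (add_mset (Suc h1) (hs v)) (R + ls v)"
    using hanging_add[OF _ hang[OF UnI1[OF vW]]] unfolding weight_v by (fastforce simp: add.commute)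
  define hs' where "hs' = hs(v := add_mset (Suc h1) (hs v))"
  define ls' where "ls' = ls(v := R + ls v)"
  define Y' where "Y' = Y(v := Y v \<union> (\<Union>u\<in>A. Y u))"
  define B' where "B' = B(v := B v \<union> insert e (\<Union>u\<in>A. B u))"
  define tot where "tot w = hs w + ls w" for w
  have totA: "if h1 \<in># hs u1 then (\<Sum>u\<in>A. tot u) = add_mset h1 R else (\<Sum>u\<in>A. tot u) = {#} \<and> R = {#} \<and> h1 = 0"
  proof (cases "h1 \<in># hs u1")
    case True
    have "(\<Sum>u\<in>A. tot u) = tot u1 + (\<Sum>u\<in>A - {u1}. tot u)" using finA u1 by (rule sum.remove)
    moreover have "hs u1 = add_mset h1 (hs u1 - {#h1#})" using True by simp
    then have "tot u1 = add_mset h1 (hs u1 - {#h1#} + ls u1)" unfolding tot_def by (metis union_mset_add_mset_left)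
    ultimately show ?thesis using True by (simp add: R_def tot_def)
  next
    case False
    then have "hs u = {#} \<and> ls u = {#}" if "u \<in> A" for u using h1 that emp by blast
    then show ?thesis using False h1 u1 by (simp add: R_def tot_def)
  qed
  have mset_tot: "(\<Sum>w\<in>W. hs' w + ls' w) = (\<Sum>w\<in>W. tot w) + add_mset (Suc h1) R"
  proof -
    have "(\<Sum>w\<in>W. hs' w + ls' w) = (hs' v + ls' v) + (\<Sum>w\<in>W - {v}. hs' w + ls' w)"
      using finW vW by (rule sum.remove)
    also have "(\<Sum>w\<in>W - {v}. hs' w + ls' w) = (\<Sum>w\<in>W - {v}. tot w)"
      by (intro sum.cong) (auto simp: hs'_def ls'_def tot_def)
    also have "hs' v + ls' v = tot v + add_mset (Suc h1) R" by (simp add: hs'_def ls'_def tot_def)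
    finally show ?thesis using sum.remove[OF finW vW, of tot] by (simp add: add_ac)
  qed
  have mset_sum: "\<Sum>\<^sub># (\<Sum>w\<in>C. f w) = (\<Sum>w\<in>C. \<Sum>\<^sub># (f w))" for f :: "'a \<Rightarrow> nat multiset" and C
    by (induction C rule: infinite_finite_induct) auto
  have size_sum: "size (\<Sum>w\<in>C. f w) = (\<Sum>w\<in>C. size (f w))" for f :: "'a \<Rightarrow> nat multiset" and C
    by (induction C rule: infinite_finite_induct) auto
  have split: "(\<Sum>w\<in>W \<union> A. tot w) = (\<Sum>w\<in>W. tot w) + (\<Sum>u\<in>A. tot u)"
    using finW finA WA by (rule sum.union_disjoint)
  have "\<Sum>\<^sub># (\<Sum>w\<in>W \<union> A. tot w) = card (edges H - insert e F)"
    unfolding mset_sum tot_def by (rule st_edges)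
  moreover have "card (edges H - F) = Suc (card (edges H - insert e F))"
    unfolding diff by (subst card_insert_disjoint) (auto intro: finE)
  ultimately have count_edges: "(\<Sum>w\<in>W. \<Sum>\<^sub># (hs' w + ls' w)) = card (edges H - F)"
    unfolding mset_sum[symmetric] mset_tot split using totA by (auto split: if_splits)
  have fin_pend: "finite (pendants - C)" for C using finite_edges by (simp add: pendants_def)
  have "size (\<Sum>w\<in>W \<union> A. tot w) = card (pendants - insert e F)"
    unfolding size_sum tot_def by (rule st_pend)
  moreover have "card (pendants - F) = (if \<forall>u\<in>A. hs u = {#} then Suc (card (pendants - insert e F))
      else card (pendants - insert e F))"
  proof (cases "e \<in> pendants")
    case True
    then have eq: "pendants - F = insert e (pendants - insert e F)" using F by blast
    have "card (pendants - F) = Suc (card (pendants - insert e F))"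
      unfolding eq by (rule card_insert_disjoint[OF fin_pend]) blast
    then show ?thesis using True pend by presburger
  next
    case False
    then have "card (pendants - F) = card (pendants - insert e F)" by (intro arg_cong[of _ _ card]) blast
    then show ?thesis using False pend by presburger
  qed
  moreover have "h1 \<in># hs u1 \<longleftrightarrow> \<not> (\<forall>u\<in>A. hs u = {#})"
  proof
    assume "h1 \<in># hs u1"
    then have "hs u1 \<noteq> {#}" by auto
    then show "\<not> (\<forall>u\<in>A. hs u = {#})" using u1 by blast
  qed (use h1 in blast)
  moreover have "(\<Sum>u\<in>A. size (tot u)) = (if h1 \<in># hs u1 then Suc (size R) else 0)"
    unfolding size_sum[symmetric] using totA by (cases "h1 \<in># hs u1") (simp_all only: if_True if_False size_add_mset size_empty)
  ultimately have count_pend: "(\<Sum>w\<in>W. size (hs' w + ls' w)) = card (pendants - F)"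
    unfolding size_sum[symmetric] mset_tot split using totA by (auto split: if_splits)
  \<comment> \<open>If no path is detached at \<open>v\<close>, then at most one path hangs at
    \<open>u1\<close> and nothing at the other lower vertices, so those are the free points of the
    first edge of a new leg.\<close>
  have spider_v: "is_spider k v (Y' v) (B' v) (hs' v)" if "ls' v = {#}"
  proof -
    have R0: "R = {#}" and lv: "ls v = {#}" using that by (auto simp: ls'_def)
    have hsu1: "hs u1 - {#h1#} = {#}" and lsu1: "ls u1 = {#}" and rest: "(\<Sum>u\<in>A - {u1}. hs u + ls u) = {#}"
      using R0 by (auto simp: R_def)
    have "set_mset (hs u + ls u) \<subseteq> set_mset (\<Sum>u\<in>A - {u1}. hs u + ls u)" if "u \<in> A - {u1}" for u
      using finA that by (subst set_mset_sum) auto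
    then have others: "hs u = {#} \<and> ls u = {#}" if "u \<in> A - {u1}" for u using that rest by fastforce
    have YB: "Y u = {u} \<and> B u = {}" if "u \<in> A - {u1}" for u
      using spider[of u] others[OF that] that by (auto dest: is_spider_emptyD)
    have hs1: "size (hs u1) \<le> 1" and sum1: "\<Sum>\<^sub># (hs u1) = h1"
    proof -
      have "hs u1 = {#h1#} \<or> hs u1 = {#} \<and> h1 = 0"
        using h1 hsu1 u1 by (metis insert_DiffM)
      then show "size (hs u1) \<le> 1" "\<Sum>\<^sub># (hs u1) = h1" by auto
    qed
    have "is_spider k v (Y v \<union> (Y u1 \<union> (A - {u1}))) (B v \<union> insert (insert v (insert u1 (A - {u1}))) (B u1))
       (add_mset (Suc (\<Sum>\<^sub># (hs u1))) (hs v))"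
    proof (rule is_spider_add_leg[OF k spider[OF _ lv] spider[OF _ lsu1] hs1])
      show "v \<in> W \<union> A" "u1 \<in> W \<union> A" using vW u1 by auto
      show "finite (A - {u1})" using finA by simp
      show "card (A - {u1}) = k - 2" using cardA u1 by (simp add: card_Diff_singleton)
      show "Y v \<inter> Y u1 = {}" using disj vW u1 vA by blast
      have "u \<notin> Y v \<and> u \<notin> Y u1" if u: "u \<in> A - {u1}" for u
      proof -
        have "u \<in> Y u" using YB[OF u] by simp
        moreover have "Y u \<inter> Y v = {}" "Y u \<inter> Y u1 = {}" using disj[of u v] disj[of u u1] u u1 vW vA by auto
        ultimately show ?thesis by blast
      qed
      then show "(A - {u1}) \<inter> Y v = {}" "(A - {u1}) \<inter> Y u1 = {}" by blast+
    qed
    moreover have "(\<Union>u\<in>A. Y u) = Y u1 \<union> (\<Union>u\<in>A - {u1}. Y u)" "(\<Union>u\<in>A. B u) = B u1 \<union> (\<Union>u\<in>A - {u1}. B u)"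
      using u1 by blast+
    moreover have "(\<Union>u\<in>A - {u1}. Y u) = (\<Union>u\<in>A - {u1}. {u})" "(\<Union>u\<in>A - {u1}. B u) = (\<Union>u\<in>A - {u1}. {})"
      using YB by (intro SUP_cong; blast)+
    ultimately have "is_spider k v (Y v \<union> (Y u1 \<union> (A - {u1}))) (B v \<union> insert (insert v (insert u1 (A - {u1}))) (B u1))
       (add_mset (Suc (\<Sum>\<^sub># (hs u1))) (hs v))" and Y'v: "Y' v = Y v \<union> (Y u1 \<union> (A - {u1}))"
      and B'v: "B' v = B v \<union> insert e (B u1)"
      by (simp_all add: Y'_def B'_def)
    moreover have "insert v (insert u1 (A - {u1})) = e" using eA u1 by blast
    ultimately show ?thesis unfolding Y'v B'v using sum1 by (simp add: hs'_def)
  qed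
  have "stripped W F hs' ls' Y' B'"
    unfolding stripped_def
  proof (intro conjI ballI impI)
    fix w assume w: "w \<in> W"
    show "hanging (ratio w) (weight F w) (hs' w) (ls' w)"
      using hang_v hang[of w] weight_w[of w] w by (cases "w = v") (auto simp: hs'_def ls'_def)
    show "size (hs' w) = card {c \<in> edges H - F. w \<in> c}"
    proof (cases "w = v")
      case True
      then show ?thesis unfolding True inc_v using size[of v] vW finE
        by (subst card_insert_disjoint) (auto simp: hs'_def)
    next
      case False
      then show ?thesis using inc_w[OF w False] size[of w] w by (simp add: hs'_def)
    qed
    show "is_spider k w (Y' w) (B' w) (hs' w)" if "ls' w = {#}"
    proof (cases "w = v")
      case False
      then show ?thesis using spider[of w] that w by (simp add: hs'_def ls'_def Y'_def B'_def)
    qed (use spider_v that in blast)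
  next
    have "(\<Union>w\<in>W. Y' w) = (\<Union>w\<in>W \<union> A. Y w)" using vW by (auto simp: Y'_def split: if_splits)
    then show "(\<Union>w\<in>W. Y' w) = verts H" using st_Y by simp
  next
    have "(\<Union>w\<in>W. B' w) = insert e (\<Union>w\<in>W \<union> A. B w)" using vW by (auto simp: B'_def split: if_splits)
    then show "(\<Union>w\<in>W. B' w) = edges H - F" unfolding st_B diff by simp
  next
    fix w w' assume w: "w \<in> W" "w' \<in> W" "w \<noteq> w'"
    have *: "Y' v \<inter> Y a = {}" if a: "a \<in> W" "a \<noteq> v" for a
    proof -
      have "Y u \<inter> Y a = {}" if "u \<in> insert v A" for u
        using that a vW WA by (intro disj) auto
      then show ?thesis by (auto simp: Y'_def)
    qed
    have Yw: "Y' a = Y a" if "a \<noteq> v" for a using that by (simp add: Y'_def)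
    show "Y' w \<inter> Y' w' = {}"
    proof (cases "w = v")
      case True
      then show ?thesis using *[of w'] Yw[of w'] w by simp
    next
      case False
      then show ?thesis using *[of w] Yw[of w] Yw[of w'] disj[of w w'] w by (cases "w' = v") (auto simp: Int_commute)
    qed
  qed (use count_edges count_pend in auto)
  then show ?thesis by blast
qed

lemma stripped_root:
  assumes "grown r W F" "F \<subseteq> edges H" "stripped W F hs ls Y B"
  shows "\<exists>hs ls Y B. stripped {r} {} hs ls Y B"
  using assms
proof (induction arbitrary: hs ls Y B rule: grown.induct)
  case root
  then show ?case by blast
next
  case (edge W F e v)
  then obtain hs' ls' Y' B' where "stripped W F hs' ls' Y' B'"
    using stripped_step[OF edge.prems(2) edge.hyps(1,2,3) edge.prems(1)] by blast
  then show ?case using edge.IH edge.prems(1) by blast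
qed

text \<open>Once every edge is stripped only the root is left, with ratio 1 and total weight \<mu> =
  L + \<alpha>.\<close>

theorem decomposition:
  obtains hs ls where "hanging 1 (L + \<alpha>) hs ls" "\<Sum>\<^sub># (hs + ls) = card (edges H)"
    "size (hs + ls) = card {e \<in> edges H. pendant_edge H e}"
    "ls = {#} \<longrightarrow> is_spider k r (verts H) (edges H) hs"
proof -
  obtain hs ls Y B where "stripped {r} {} hs ls Y B"
    using stripped_root[OF hypertree_grown[OF tree r] subset_refl stripped_start] by blast
  moreover have "ratio r = 1" using x_pos[OF r] by (simp add: ratio_def)
  moreover have "weight {} r = L + \<alpha>" using g_sum[OF r] by (simp add: weight_def L_def)
  ultimately show thesis using that[of "hs r" "ls r"] by (auto simp: stripped_def pendants_def)
qed

end

section \<open>The extremal hypertree\<close>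

text \<open>Since a positive eigenvector identifies the spectral radius, this is all that is needed
  for its invariance under isomorphism.\<close>

lemma positive_eigenvector_transfer:
  assumes f: "bij_betw f (verts G) (verts H)" "(\<lambda>e. f ` e) ` edges G = edges H" and G: "hypergraph G"
    and x: "positive_eigenvector k \<alpha> H \<mu> x"
  shows "positive_eigenvector k \<alpha> G \<mu> (x \<circ> f)"
  unfolding positive_eigenvector_def
proof
  fix v assume v: "v \<in> verts G"
  have sub: "e \<subseteq> verts G" if "e \<in> edges G" for e using G that by (auto simp: hypergraph_def)
  have inj: "inj_on f (verts G)" using f(1) by (simp add: bij_betw_def)
  have fv: "f v \<in> verts H" using f(1) v by (auto simp: bij_betw_def)
  have mem: "f v \<in> f ` e \<longleftrightarrow> v \<in> e" if "e \<in> edges G" for e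
    using inj_on_image_mem_iff[OF inj v sub[OF that]] .
  have injE: "inj_on (\<lambda>e. f ` e) {e\<in>edges G. v \<in> e}"
  proof (rule inj_onI)
    fix e e' assume "e \<in> {e\<in>edges G. v \<in> e}" "e' \<in> {e\<in>edges G. v \<in> e}" "f ` e = f ` e'"
    then show "e = e'" using inj_on_image_eq_iff[OF inj sub sub, of e e'] by simp
  qed
  have inc: "{e\<in>edges H. f v \<in> e} = (\<lambda>e. f ` e) ` {e\<in>edges G. v \<in> e}"
  proof -
    have "(f ` e \<in> edges H \<and> f v \<in> f ` e) = (e \<in> edges G \<and> v \<in> e)" if "e \<in> edges G" for e
      using that mem[OF that] f(2) by blast
    then show ?thesis unfolding f(2)[symmetric] by blast
  qed
  have "degree H (f v) = degree G v" unfolding degree_def inc using injE by (rule card_image)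
  moreover have "nbsum (edges H) x (f v) = nbsum (edges G) (x \<circ> f) v"
    unfolding nbsum_def inc sum.reindex[OF injE] o_def
  proof (rule sum.cong[OF refl])
    fix e assume e: "e \<in> {e\<in>edges G. v \<in> e}"
    then have "inj_on f (e - {v})" using inj_on_subset[OF inj] sub by blast
    moreover have "f ` e - {f v} = f ` (e - {v})"
      using inj_on_image_set_diff[OF inj, of e "{v}"] sub e v by auto
    ultimately show "(\<Prod>u\<in>f ` e - {f v}. x u) = (\<Prod>u\<in>e - {v}. x (f u))" by (simp add: prod.reindex)
  qed
  moreover have "0 < x (f v) \<and> \<alpha> * real (degree H (f v)) * x (f v) ^ (k - 1) +
      (1 - \<alpha>) * nbsum (edges H) x (f v) = \<mu> * x (f v) ^ (k - 1)"
    using x fv unfolding positive_eigenvector_def by blast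
  ultimately show "0 < (x \<circ> f) v \<and> \<alpha> * real (degree G v) * (x \<circ> f) v ^ (k - 1) +
      (1 - \<alpha>) * nbsum (edges G) (x \<circ> f) v = \<mu> * (x \<circ> f) v ^ (k - 1)"
    by (simp add: o_def)
qed

text \<open>If a maximal vertex lay in a single edge e, it would have g = \<mu> - \<alpha> there.
  Some vertex u of e lies in a second edge, so g(u,e) is strictly smaller, and x_u is not larger;
  this contradicts the equality of x^k g along e.\<close>

lemma (in positive_eigen) two_edges_imp_max_degree_ge_2:
  assumes cut: "cut_connected H" and E: "2 \<le> card (edges H)" and r: "r \<in> verts H"
    and r_max: "\<And>v. v \<in> verts H \<Longrightarrow> x v \<le> x r"
  shows "2 \<le> degree H r"
proof (rule ccontr)
  assume "\<not> 2 \<le> degree H r"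
  then have d: "degree H r = 0 \<or> degree H r = 1" by linarith
  have Ene: "edges H \<noteq> {}" using E by auto
  have "{e\<in>edges H. r \<in> e} \<noteq> {}"
  proof
    assume none: "{e\<in>edges H. r \<in> e} = {}"
    have "0 = \<mu>" using g_sum[OF r] unfolding none by simp
    then show False using mu_gt_alpha[OF Ene] \<alpha> by simp
  qed
  then have "degree H r \<noteq> 0" using finite_edges by (simp add: degree_def)
  then obtain e where e: "{e\<in>edges H. r \<in> e} = {e}" using d by (auto simp: degree_def card_1_singleton_iff)
  then have eH: "e \<in> edges H" "r \<in> e" by auto
  have "\<not> edges H \<subseteq> {e}" using E card_mono[of "{e}" "edges H"] by auto
  then obtain e2 where e2: "e2 \<in> edges H" "e2 \<noteq> e" by blast
  have "e \<noteq> verts H"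
  proof
    assume "e = verts H"
    then have "e2 \<subseteq> e" using edge_subset[OF e2(1)] by simp
    then show False
      using card_subset_eq[OF finite_edge[OF eH(1)]] card_edge[OF e2(1)] card_edge[OF eH(1)] e2(2) by simp
  qed
  moreover have "e \<noteq> {}" using eH(2) by blast
  ultimately obtain e' where e': "e' \<in> edges H" "e' \<inter> e \<noteq> {}" "e' \<inter> (verts H - e) \<noteq> {}"
    using cut[unfolded cut_connected_def, rule_format, of e] edge_subset[OF eH(1)] by blast
  then obtain u where u: "u \<in> e" "u \<in> e'" by blast
  have ne: "e \<noteq> e'" using e'(3) by blast
  have "g r e = \<mu> - \<alpha>" using g_sum[OF r] unfolding e by simp
  moreover have "(\<alpha> + g u e) + (\<alpha> + g u e') \<le> \<mu>" using g_le2[OF eH(1) u(1) e'(1) u(2) ne] .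
  ultimately have lt: "g u e < g r e" using g_pos[OF e'(1) u(2)] \<alpha> by linarith
  have uV: "u \<in> verts H" using u edge_subset[OF eH(1)] by blast
  have "x u ^ k \<le> x r ^ k" using r_max[OF uV] x_pos[OF uV] by (intro power_mono) auto
  then have "x u ^ k * g u e < x r ^ k * g r e"
    using lt g_pos[OF eH(1) u(1)] x_pos[OF r] x_pos[OF uV] by (intro mult_le_less_imp_less) auto
  then show False using g_ratio[OF eH(1) eH(2) u(1)] by simp
qed

text \<open>The chain L + \<alpha> <= legsum hs + legsum ls <= legsum N <= L + \<alpha> collapses.
  Its first inequality is strict if a path was detached; and if \<open>hs\<close> were unbalanced,
  one more balancing move would raise the sum strictly beyond the bound.\<close>

lemma (in leg_weights) hanging_extremal:
  assumes hang: "hanging 1 (L + \<alpha>) hs ls"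
    and N: "balanced N" "2 \<le> size N" "\<And>j. j \<in># N \<Longrightarrow> valid j" "legsum N \<le> L + \<alpha>"
    and size: "size (hs + ls) = size N" and sum: "\<Sum>\<^sub># (hs + ls) = \<Sum>\<^sub># N"
  shows "legsum N = L + \<alpha> \<and> ls = {#} \<and> hs = N"
proof -
  have le_N: "legsum M \<le> legsum N" if "size M = size N" "\<Sum>\<^sub># M = \<Sum>\<^sub># N" "\<And>j. j \<in># M \<Longrightarrow> 1 \<le> j" for M
    using legsum_le_balanced[OF N that] by blast
  have pos: "1 \<le> j" if "j \<in># hs + ls" for j using hang that by (auto simp: hanging_def)
  have hl: "legsum hs + legsum ls \<le> legsum N" using le_N[OF size sum pos] by simp
  have ls: "ls = {#}"
  proof (rule ccontr)
    assume "ls \<noteq> {#}"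
    then have "L + \<alpha> < legsum hs + legsum ls" using hang by (simp add: hanging_def)
    then show False using hl N(4) by linarith
  qed
  then have sumhs: "L + \<alpha> = legsum hs" using hang by (simp add: hanging_def)
  then have eq: "legsum N = L + \<alpha>" using hl ls N(4) by simp
  have "balanced hs"
  proof (rule ccontr)
    assume "\<not> balanced hs"
    then obtain i j R where hs: "hs = {#i, Suc j#} + R" and ij: "i < j" by (rule not_balanced_split)
    \<comment> \<open>With z = 1 the condition in \<open>hanging\<close> on the first edge of the
      path says that c is at most the square of L - s j, as the strict comparison requires.\<close>
    have v: "valid (Suc j)" and "s (Suc j) - \<alpha> \<le> L - s j" using hang by (auto simp: hanging_def hs)
    then have "c / (L - s j) \<le> L - s j" "s j < L" by (auto simp: valid_Suc)
    then have "c \<le> (L - s j) * (L - s j)" by (simp add: divide_le_eq)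
    then have "s i + s (Suc j) < s (Suc i) + s j" by (rule shift_less[OF ij v])
    then have "legsum hs < legsum ({#Suc i, j#} + R)" by (simp add: hs del: leg.simps)
    moreover have "legsum ({#Suc i, j#} + R) \<le> legsum N"
      by (rule le_N) (use size sum ls hs pos ij in auto)
    ultimately show False using sumhs N(4) by linarith
  qed
  moreover have "hs \<noteq> {#}" "N \<noteq> {#}" using size ls N(2) by auto
  ultimately have "hs = N" using balanced_eq[of hs] balanced_eq[OF N(1)] size sum ls by simp
  then show ?thesis using eq ls by blast
qed

lemma set_Tlens: "set_mset (mset (Tlens m t)) = Tlen m t ` {1..t}"
  by (simp add: Tlens_def atLeastLessThanSuc_atLeastAtMost del: upt_Suc)

lemma sum_Tlens: "\<Sum>\<^sub># (image_mset f (mset (Tlens m t))) = (\<Sum>j\<in>{1..t}. f (Tlen m t j))"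
  unfolding mset_map[symmetric] sum_mset_sum_list Tlens_def map_map
  by (simp add: sum_list_distinct_conv_sum_set atLeastLessThanSuc_atLeastAtMost del: upt_Suc)

lemma Tlens_properties:
  assumes "1 \<le> t" "t \<le> m"
  shows "balanced (mset (Tlens m t))" "size (mset (Tlens m t)) = t" "\<Sum>\<^sub># (mset (Tlens m t)) = m"
proof -
  show "balanced (mset (Tlens m t))" by (auto simp: balanced_def set_Tlens Tlen_def simp del: set_mset_mset)
  show "size (mset (Tlens m t)) = t" by (simp add: Tlens_def del: upt_Suc)
  have "\<Sum>\<^sub># (mset (Tlens m t)) = (\<Sum>j\<in>{1..t}. Tlen m t j)"
    using sum_Tlens[of "\<lambda>n. n" m t] by simp
  also have "\<dots> = t * (m div t) + card {j\<in>{1..t}. j \<le> m mod t}"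
    by (simp add: Tlen_def sum.distrib sum.If_cases Int_def)
  also have "{j\<in>{1..t}. j \<le> m mod t} = {1..m mod t}"
  proof -
    have "m mod t < t" using assms(1) by simp
    then show ?thesis by auto
  qed
  finally show "\<Sum>\<^sub># (mset (Tlens m t)) = m" by simp
qed

theorem theorem5p4:
  fixes G :: "'a hgraph" and k m t :: nat and \<alpha> :: real
  assumes "k \<ge> 2" and "0 \<le> \<alpha>" and "\<alpha> < 1"
    and "uniform k G" and "hypertree G"
    and "card (edges G) = m"
    and "card {e \<in> edges G. pendant_edge G e} = t" and "t \<ge> 2"
  shows "rho_alpha k \<alpha> G \<le> rho_alpha k \<alpha> (T_mtk m t k) \<and>
         (rho_alpha k \<alpha> G = rho_alpha k \<alpha> (T_mtk m t k) \<longleftrightarrow> hg_iso G (T_mtk m t k))"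
proof -
  let ?T = "T_mtk m t k"
  note k = assms(1) and \<alpha> = assms(2,3) and unif = assms(4) and tree = assms(5)
  have hyp: "hypergraph G" and cut: "cut_connected G"
    using tree connected_hg_imp_cut_connected[of G] by (auto simp: hypertree_def)
  have finE: "finite (edges G)"
    using hyp by (meson PowI finite_Pow_iff finite_subset hypergraph_def subsetI)
  have tm: "t \<le> m" using assms(6,7) card_mono[OF finE, of "{e \<in> edges G. pendant_edge G e}"] by auto
  have E2: "2 \<le> card (edges G)" using assms(6,8) tm by simp
  then have "edges G \<noteq> {}" by auto
  then have Gne: "verts G \<noteq> {}" using hyp by (fastforce simp: hypergraph_def)
  have Tne: "verts ?T \<noteq> {}" using verts_T_mtk[of "(0, 0, 0)" m t k] by auto
  obtain \<mu> x where eigG: "positive_eigenvector k \<alpha> G \<mu> x"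
    using positive_eigenvector_exists[OF unif k Gne cut \<alpha>] by blast
  obtain \<nu> y where eigT: "positive_eigenvector k \<alpha> ?T \<nu> y"
    using positive_eigenvector_exists[OF uniform_T_mtk[OF k] k Tne cut_connected_T_mtk \<alpha>] by blast
  have rhoG: "rho_alpha k \<alpha> G = \<mu>" by (rule rho_alpha_eq_positive_eigenvalue[OF unif k Gne \<alpha> eigG])
  have rhoT: "rho_alpha k \<alpha> ?T = \<nu>" by (rule rho_alpha_eq_positive_eigenvalue[OF uniform_T_mtk[OF k] k Tne \<alpha> eigT])
  have iso_imp: "\<mu> = \<nu>" if iso: "hg_iso G ?T"
  proof -
    obtain f where "bij_betw f (verts G) (verts ?T)" "(\<lambda>e. f ` e) ` edges G = edges ?T"
      using iso by (auto simp: hg_iso_def)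
    then have "positive_eigenvector k \<alpha> G \<nu> (y \<circ> f)"
      by (rule positive_eigenvector_transfer[OF _ _ hyp eigT])
    then show ?thesis using rho_alpha_eq_positive_eigenvalue[OF unif k Gne \<alpha>] rhoG by simp
  qed
  \<comment> \<open>This case suffices: if \<mu> < \<nu>, the inequality is strict and
    \<open>iso_imp\<close> rules out an isomorphism.\<close>
  have main: "\<mu> = \<nu> \<and> hg_iso G ?T" if le: "\<nu> \<le> \<mu>"
  proof -
    interpret positive_eigen k \<alpha> G \<mu> x using unif k \<alpha> eigG by unfold_locales
    obtain r where r: "r \<in> verts G" "\<And>v. v \<in> verts G \<Longrightarrow> x v \<le> x r"
    proof -
      have "Max (x ` verts G) \<in> x ` verts G" using finite_verts Gne by (intro Max_in) auto
      then obtain r where "r \<in> verts G" "Max (x ` verts G) = x r" by blast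
      then show thesis using that[of r] Max_ge[of "x ` verts G"] finite_verts by simp
    qed
    interpret rooted_hypertree k \<alpha> G \<mu> x r
      using tree r two_edges_imp_max_degree_ge_2[OF cut E2 r] by unfold_locales
    obtain hs ls where hang: "hanging 1 (L + \<alpha>) hs ls" and sum: "\<Sum>\<^sub># (hs + ls) = card (edges G)"
      and size: "size (hs + ls) = card {e \<in> edges G. pendant_edge G e}"
      and spider: "ls = {#} \<longrightarrow> is_spider k r (verts G) (edges G) hs"
      by (rule decomposition)
    define N where "N = mset (Tlens m t)"
    have t1: "1 \<le> t" using assms(8) by simp
    note Np = Tlens_properties[OF t1 tm, folded N_def]
    have La: "L + \<alpha> = \<mu>" unfolding L_def by simp
    \<comment> \<open>The legs of the extremal hypertree are evaluated with the \<open>L\<close> and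
      \<open>c\<close> of \<open>G\<close>; the case assumption is what makes them valid
      there.\<close>
    have "\<nu> \<le> L + \<alpha>" using le unfolding La .
    then have legs: "\<forall>j\<in>{1..t}. valid (Tlen m t j)" "(\<Sum>j\<in>{1..t}. s (Tlen m t j)) \<le> \<nu>"
      using T_mtk_legs[OF k t1 tm \<alpha>(2) eigT _ c_L] by blast+
    have N: "valid j" if "j \<in># N" for j
    proof -
      have "j \<in> Tlen m t ` {1..t}" using that unfolding N_def set_Tlens .
      then show ?thesis using legs(1) by blast
    qed
    have N': "legsum N \<le> \<nu>" using legs(2) unfolding N_def sum_Tlens .
    have "legsum N \<le> L + \<alpha>" using N' le unfolding La by (rule order_trans)
    note ext = hanging_extremal[OF hang Np(1) _ N this, unfolded Np(2,3), OF assms(8) _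
      size[unfolded assms(7)] sum[unfolded assms(6)]]
    then have ext: "legsum N = L + \<alpha>" "ls = {#}" "hs = N" by blast+
    have "\<mu> \<le> \<nu>" using N' unfolding ext(1) La .
    then have eq: "\<mu> = \<nu>" using le by (rule order_antisym)
    have "hg_iso G ?T" 
      using spider[THEN mp, OF ext(2)] unfolding ext(3) N_def by (rule is_spider_iso_T)
    then show ?thesis using eq by blast
  qed
  show ?thesis unfolding rhoG rhoT using main iso_imp by (cases "\<nu> \<le> \<mu>") auto
qed

end
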